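(* Let $f$ be a non-negative (continuous) operator monotone function on $[0,\infty)$ with $f(1)=1$, and let $\sigma_f$ be the corresponding operator mean. Assume that $f(0)=0$ and $f(x^r)\ge f(x)^r$ for all $x>0$ and all $r\in(0,1)$. Let $A\in\mathbb{M}_n^+$ and let $E\in\mathbb{M}_n$ be an orthogonal projection. Then $$(A^p\,\sigma_f\,E)^{1/p}\ge(A^q\,\sigma_f\,E)^{1/q}\quad\text{if } 1\le p<q.$$
   Context: $\mathbb{M}_n$ is the algebra of $n\times n$ complex matrices and $\mathbb{M}_n^+$ the set of positive semidefinite matrices in $\mathbb{M}_n$; $\ge$ between Hermitian matrices is the positive semidefinite (Loewner) order. A real function $f$ on $[0,\infty)$ is operator monotone if $X\ge Y\ge0$ implies $f(X)\ge f(Y)$ for positive semidefinite matrices of every size. The operator mean (in the sense of Kubo-Ando) associated with $f$ is defined by $A\sigma_fB:=A^{1/2}f(A^{-1/2}BA^{-1/2})A^{1/2}$ for $A,B\in\mathbb{M}_n^+$ with $A$ positive definite, and extended to general $A,B\in\mathbb{M}_n^+$ by $A\sigma_fB:=\lim_{\varepsilon\searrow0}(A+\varepsilon I)\sigma_f(B+\varepsilon I)$. Powers $X^p$ with $p>0$ of positive semidefinite matrices are defined by functional calculus. *)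

theory Defs
  imports Complex_Main "Jordan_Normal_Form.Schur_Decomposition"
begin

definition hermitian_mat :: "nat \<Rightarrow> complex mat \<Rightarrow> bool" where
  "hermitian_mat n A \<longleftrightarrow> A \<in> carrier_mat n n \<and> mat_adjoint A = A"

definition psd_mat :: "nat \<Rightarrow> complex mat \<Rightarrow> bool" where
  "psd_mat n A \<longleftrightarrow> hermitian_mat n A \<and> (\<forall>v \<in> carrier_vec n. 0 \<le> Re ((A *\<^sub>v v) \<bullet>c v))"

definition pd_mat :: "nat \<Rightarrow> complex mat \<Rightarrow> bool" where
  "pd_mat n A \<longleftrightarrow> hermitian_mat n A \<and>
     (\<forall>v \<in> carrier_vec n. v \<noteq> 0\<^sub>v n \<longrightarrow> 0 < Re ((A *\<^sub>v v) \<bullet>c v))"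

text \<open>The library order \<open>\<le>\<close> on matrices is entrywise, so the Loewner order gets a name of its own.\<close>

definition loewner_ge :: "nat \<Rightarrow> complex mat \<Rightarrow> complex mat \<Rightarrow> bool" where
  "loewner_ge n A B \<longleftrightarrow> hermitian_mat n A \<and> hermitian_mat n B \<and> psd_mat n (A - B)"

definition unitary_mat :: "nat \<Rightarrow> complex mat \<Rightarrow> bool" where
  "unitary_mat n U \<longleftrightarrow> U \<in> carrier_mat n n \<and>
     U * mat_adjoint U = 1\<^sub>m n \<and> mat_adjoint U * U = 1\<^sub>m n"

definition projection_mat :: "nat \<Rightarrow> complex mat \<Rightarrow> bool" where
  "projection_mat n E \<longleftrightarrow> hermitian_mat n E \<and> E * E = E"

text \<open>Functional calculus for a Hermitian matrix: if \<open>A = U diag(d) U\<^sup>*\<close> with \<open>U\<close> unitary and \<open>d\<close> real,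
  then \<open>f(A) = U diag(f \<circ> d) U\<^sup>*\<close>. This does not depend on the diagonalization that is chosen;
  if \<open>A\<close> is not Hermitian, the value is unspecified.\<close>

definition fun_calc :: "(real \<Rightarrow> real) \<Rightarrow> complex mat \<Rightarrow> complex mat" where
  "fun_calc f A = (THE B. \<exists>U d. unitary_mat (dim_row A) U \<and>
     A = U * mat_diag (dim_row A) (\<lambda>i. complex_of_real (d i)) * mat_adjoint U \<and>
     B = U * mat_diag (dim_row A) (\<lambda>i. complex_of_real (f (d i))) * mat_adjoint U)"

text \<open>Since \<open>0 powr p = 0\<close>, for \<open>p > 0\<close> this is the usual power on all positive semidefinite matrices;
  a negative \<open>p\<close> is used for positive definite matrices only.\<close>

definition mat_powr :: "complex mat \<Rightarrow> real \<Rightarrow> complex mat" where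
  "mat_powr A p = fun_calc (\<lambda>x. x powr p) A"

text \<open>Only the values of \<open>f\<close> on \<open>[0,\<infinity>)\<close> matter, because the eigenvalues of \<open>X\<close> and \<open>Y\<close> are non-negative.\<close>

definition operator_monotone :: "(real \<Rightarrow> real) \<Rightarrow> bool" where
  "operator_monotone f \<longleftrightarrow>
     (\<forall>m X Y. psd_mat m X \<and> psd_mat m Y \<and> loewner_ge m X Y
        \<longrightarrow> loewner_ge m (fun_calc f X) (fun_calc f Y))"

definition op_mean_pd :: "(real \<Rightarrow> real) \<Rightarrow> complex mat \<Rightarrow> complex mat \<Rightarrow> complex mat" where
  "op_mean_pd f A B =
     mat_powr A (1/2) * fun_calc f (mat_powr A (-1/2) * B * mat_powr A (-1/2)) * mat_powr A (1/2)"

text \<open>The limit \<open>\<epsilon> \<searrow> 0\<close> is taken entrywise, which in finite dimension is convergence in norm.\<close>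

definition op_mean :: "(real \<Rightarrow> real) \<Rightarrow> complex mat \<Rightarrow> complex mat \<Rightarrow> complex mat" where
  "op_mean f A B = (let n = dim_row A in
     if pd_mat n A then op_mean_pd f A B
     else mat n n (\<lambda>(i, j). Lim (at_right (0::real)) (\<lambda>\<epsilon>.
       op_mean_pd f (A + complex_of_real \<epsilon> \<cdot>\<^sub>m 1\<^sub>m n) (B + complex_of_real \<epsilon> \<cdot>\<^sub>m 1\<^sub>m n) $$ (i, j))))"

end

theory Submission
  imports "HOL-Analysis.Equivalence_Lebesgue_Henstock_Integration" Defs
begin

unbundle no vec_syntax and no inner_syntax

text \<open>
Write \<open>\<sigma>\<close> for the mean of \<open>f\<close>, \<open>g(x) = f(x) / x\<close> and \<open>F = 1 - E\<close>. For positive definite \<open>A\<close>, the rule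
\<open>f(T T\<^sup>*) = T g(T\<^sup>* T) T\<^sup>*\<close> with \<open>T = A\<^sup>-\<^sup>1\<^sup>/\<^sup>2 E\<close> turns the mean with a projection into
\<open>A \<sigma> E = E g(Z) E\<close>, where \<open>Z = E A\<^sup>-\<^sup>1 E + F\<close> (\<open>op_mean_pd_projection\<close>).

The heart of the matter is \<open>A\<^sup>r \<sigma> E \<ge> (A \<sigma> E)\<^sup>r\<close> for \<open>0 < r < 1\<close> (\<open>op_mean_pd_projection_powr\<close>). It
combines three inequalities. First, compressing a power is smaller than the power of the compression,
so that \<open>Z\<^sup>r \<ge> E A\<^sup>-\<^sup>r E + F\<close> (\<open>completed_compression_powr\<close>). Second, \<open>g\<close> reverses the Loewner order
(\<open>operator_monotone_quotient_antimono\<close>). Third, the hypothesis on \<open>f\<close> says \<open>g(x\<^sup>r) \<ge> g(x)\<^sup>r\<close>. Applied to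
\<open>A\<^sup>q\<close> with \<open>r = p / q\<close> this gives \<open>A\<^sup>p \<sigma> E \<ge> (A\<^sup>q \<sigma> E)\<^sup>p\<^sup>/\<^sup>q\<close>, and the Loewner-Heinz inequality with the
exponent \<open>1 / p \<le> 1\<close> finishes the proof (\<open>loewner_heinz\<close>).

The first two inequalities come from a single one, \<open>E f(X) E \<le> E f(E X E) E\<close> for operator monotone \<open>f\<close>
(\<open>operator_monotone_compression\<close>), applied to \<open>x\<^sup>r\<close> and, in doubled dimension, to \<open>f\<close>. It holds because
\<open>X\<close> is dominated by a block diagonal matrix with almost the same \<open>E\<close>-block. The Loewner-Heinz
inequality follows by writing \<open>x\<^sup>s\<close> as an integral of the functions \<open>x / (x + t)\<close>.

If \<open>A\<close> is singular, the mean is a limit of regularized means. It is also the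
greatest lower bound of the means \<open>(A + \<epsilon>) \<sigma> E\<close>, in which the projection is left alone
(\<open>op_mean_singular\<close>), and this reduces the claim to the positive definite case.
\<close>

section \<open>Adjoints and quadratic forms\<close>

lemma dim_mat_adjoint [simp]:
  "dim_row (mat_adjoint A) = dim_col A" "dim_col (mat_adjoint A) = dim_row A"
  by (auto simp: mat_adjoint_def)

lemma mat_adjoint_carrier [simp, intro]:
  "A \<in> carrier_mat n m \<Longrightarrow> mat_adjoint A \<in> carrier_mat m n"
  by (intro carrier_matI) simp_all

lemma index_mat_adjoint [simp]:
  fixes A :: "complex mat"
  shows "i < dim_col A \<Longrightarrow> j < dim_row A \<Longrightarrow> mat_adjoint A $$ (i, j) = cnj (A $$ (j, i))"
  by (simp add: mat_adjoint_def mat_of_rows_def)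

text \<open>The ring laws for matrices are stated with equations between dimensions instead of carrier sets:
in this form rewriting can discharge the side conditions for nested products of rectangular
matrices.\<close>

lemma mat_mult_assoc:
  fixes A B C :: "complex mat"
  assumes "dim_col A = dim_row B" "dim_col B = dim_row C"
  shows "(A * B) * C = A * (B * C)"
  by (rule assoc_mult_mat[of _ "dim_row A" "dim_col A" _ "dim_col B" _ "dim_col C"])
    (use assms in auto)


lemma mat_mult_distribs:
  fixes A B C :: "complex mat"
  assumes "dim_row A = dim_row B" "dim_col A = dim_col B"
  shows "dim_col A = dim_row C \<Longrightarrow> (A + B) * C = A * C + B * C"
    and "dim_col A = dim_row C \<Longrightarrow> (A - B) * C = A * C - B * C"
    and "dim_col C = dim_row A \<Longrightarrow> C * (A + B) = C * A + C * B"
    and "dim_col C = dim_row A \<Longrightarrow> C * (A - B) = C * A - C * B"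
proof -
  have A: "A \<in> carrier_mat (dim_row A) (dim_col A)" and B: "B \<in> carrier_mat (dim_row A) (dim_col A)"
    by (simp_all only: carrier_matI assms)
  show "(A + B) * C = A * C + B * C" if "dim_col A = dim_row C"
    by (rule add_mult_distrib_mat[OF A B]) (rule carrier_matI[OF that[symmetric] refl])
  show "(A - B) * C = A * C - B * C" if "dim_col A = dim_row C"
    by (rule minus_mult_distrib_mat[OF A B]) (rule carrier_matI[OF that[symmetric] refl])
  show "C * (A + B) = C * A + C * B" if "dim_col C = dim_row A"
    by (rule mult_add_distrib_mat[OF _ A B]) (rule carrier_matI[OF refl that])
  show "C * (A - B) = C * A - C * B" if "dim_col C = dim_row A"
    by (rule mult_minus_distrib_mat[OF _ A B]) (rule carrier_matI[OF refl that])
qed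

lemma mat_mult_smult:
  fixes A B :: "complex mat"
  assumes "dim_col A = dim_row B"
  shows "(c \<cdot>\<^sub>m A) * B = c \<cdot>\<^sub>m (A * B)" "A * (c \<cdot>\<^sub>m B) = c \<cdot>\<^sub>m (A * B)"
proof -
  have A: "A \<in> carrier_mat (dim_row A) (dim_row B)" and B: "B \<in> carrier_mat (dim_row B) (dim_col B)"
    by (simp_all only: carrier_matI assms)
  show "(c \<cdot>\<^sub>m A) * B = c \<cdot>\<^sub>m (A * B)" by (rule mult_smult_assoc_mat[OF A B])
  show "A * (c \<cdot>\<^sub>m B) = c \<cdot>\<^sub>m (A * B)" by (rule mult_smult_distrib[OF A B])
qed

lemma smult_zero_one_mat [simp]:
  "(0 :: complex) \<cdot>\<^sub>m 1\<^sub>m n = 0\<^sub>m n n" "(1 :: complex) \<cdot>\<^sub>m A = A"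
  by (rule eq_matI; simp)+

lemmas mat_ring = mat_mult_assoc mat_mult_distribs mat_mult_smult

lemma mat_adjoint_mult:
  fixes A B :: "complex mat"
  assumes "dim_col A = dim_row B"
  shows "mat_adjoint (A * B) = mat_adjoint B * mat_adjoint A"
  by (rule eq_matI) (use assms in \<open>auto simp: scalar_prod_def intro!: sum.cong\<close>)

lemma mat_adjoint_adjoint [simp]: "mat_adjoint (mat_adjoint A) = (A :: complex mat)"
  by (rule eq_matI) auto

lemma mat_adjoint_arith:
  fixes A B :: "complex mat"
  assumes "dim_row A = dim_row B" "dim_col A = dim_col B"
  shows "mat_adjoint (A + B) = mat_adjoint A + mat_adjoint B"
    and "mat_adjoint (A - B) = mat_adjoint A - mat_adjoint B"
   apply (rule eq_matI; use assms in simp)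
  apply (rule eq_matI; use assms in simp)
  done

lemma mat_adjoint_smult: "mat_adjoint (c \<cdot>\<^sub>m A) = cnj c \<cdot>\<^sub>m mat_adjoint (A :: complex mat)"
  by (rule eq_matI) auto

lemma mat_adjoint_one [simp]: "mat_adjoint (1\<^sub>m n) = (1\<^sub>m n :: complex mat)"
  by (rule eq_matI) auto

lemma mat_adjoint_zero [simp]: "mat_adjoint (0\<^sub>m n m) = (0\<^sub>m m n :: complex mat)"
  by (rule eq_matI) auto

lemma dim_mat_diag [simp]: "dim_row (mat_diag n f) = n" "dim_col (mat_diag n f) = n"
  by (auto simp: mat_diag_def)

lemma mat_adjoint_diag_real [simp]:
  "mat_adjoint (mat_diag n (\<lambda>i. complex_of_real (d i))) = mat_diag n (\<lambda>i. complex_of_real (d i))"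
  by (rule eq_matI) (auto simp: mat_diag_def)

lemmas mat_adjoint_simps = mat_adjoint_mult mat_adjoint_arith mat_adjoint_smult

definition qform :: "complex mat \<Rightarrow> complex vec \<Rightarrow> real" where
  "qform A v = Re ((A *\<^sub>v v) \<bullet>c v)"

lemma cscalar_prod_adjoint:
  fixes A :: "complex mat"
  assumes "A \<in> carrier_mat n m" "v \<in> carrier_vec m" "w \<in> carrier_vec n"
  shows "(A *\<^sub>v v) \<bullet>c w = v \<bullet>c (mat_adjoint A *\<^sub>v w)"
proof -
  have "(A *\<^sub>v v) \<bullet>c w = (\<Sum>i<n. \<Sum>j<m. A $$ (i,j) * v $ j * cnj (w $ i))"
    using assms by (auto simp: scalar_prod_def atLeast0LessThan sum_distrib_right intro!: sum.cong)
  also have "\<dots> = (\<Sum>j<m. \<Sum>i<n. A $$ (i,j) * v $ j * cnj (w $ i))"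
    by (rule sum.swap)
  also have "\<dots> = v \<bullet>c (mat_adjoint A *\<^sub>v w)"
    using assms
    by (auto simp: scalar_prod_def atLeast0LessThan sum_distrib_left intro!: sum.cong)
  finally show ?thesis .
qed

lemma qform_arith:
  assumes "A \<in> carrier_mat n n" "B \<in> carrier_mat n n" "v \<in> carrier_vec n"
  shows "qform (A + B) v = qform A v + qform B v"
    and "qform (A - B) v = qform A v - qform B v"
proof -
  have Av: "A *\<^sub>v v \<in> carrier_vec n" "B *\<^sub>v v \<in> carrier_vec n" "conjugate v \<in> carrier_vec n"
    using assms by auto
  show "qform (A + B) v = qform A v + qform B v"
    using Av by (simp add: qform_def add_mult_distrib_mat_vec[OF assms] add_scalar_prod_distrib[of _ n])
  show "qform (A - B) v = qform A v - qform B v"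
    using Av by (simp add: qform_def minus_mult_distrib_mat_vec[OF assms] minus_scalar_prod_distrib[of _ n])
qed

lemma qform_smult:
  assumes "A \<in> carrier_mat n n" "v \<in> carrier_vec n"
  shows "qform (complex_of_real c \<cdot>\<^sub>m A) v = c * qform A v"
proof -
  have Av: "A *\<^sub>v v \<in> carrier_vec n" "conjugate v \<in> carrier_vec n"
    using assms by auto
  have "(complex_of_real c \<cdot>\<^sub>m A) *\<^sub>v v = complex_of_real c \<cdot>\<^sub>v (A *\<^sub>v v)"
    by (rule eq_vecI) (use assms in \<open>auto simp: row_smult\<close>)
  then show "qform (complex_of_real c \<cdot>\<^sub>m A) v = c * qform A v"
    using Av by (simp add: qform_def)
qed

text \<open>\<open>S A S\<^sup>*\<close> at \<open>v\<close> is \<open>A\<close> at \<open>S\<^sup>* v\<close>; this is why congruences preserve positivity and the Loewner order.\<close>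

lemma qform_congruence:
  assumes "S \<in> carrier_mat n m" "A \<in> carrier_mat m m" "v \<in> carrier_vec n"
  shows "qform (S * A * mat_adjoint S) v = qform A (mat_adjoint S *\<^sub>v v)"
proof -
  have w: "mat_adjoint S *\<^sub>v v \<in> carrier_vec m"
    by (rule mult_mat_vec_carrier[of _ m n]) (use assms in auto)
  have "(S * A * mat_adjoint S) *\<^sub>v v = S *\<^sub>v (A *\<^sub>v (mat_adjoint S *\<^sub>v v))"
    using assms w by (simp add: assoc_mult_mat_vec[of _ n m _ n] assoc_mult_mat_vec[of _ n m _ m])
  then show ?thesis
    using assms w by (simp add: qform_def cscalar_prod_adjoint[of S n m])
qed

lemma Re_cscalar_prod_ge_0: "0 \<le> Re (v \<bullet>c v)"
  by (auto simp: scalar_prod_def intro!: add_nonneg_nonneg sum_nonneg)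

lemma Re_cscalar_prod_eq_0:
  assumes "v \<in> carrier_vec n" "Re (v \<bullet>c v) = 0"
  shows "v = 0\<^sub>v n"
proof (rule eq_vecI)
  have "(\<Sum>i<n. (cmod (v $ i))\<^sup>2) = 0"
    using assms
    by (simp add: scalar_prod_def atLeast0LessThan complex_mult_cnj cmod_power2)
  then have "\<forall>i\<in>{..<n}. (cmod (v $ i))\<^sup>2 = 0"
    by (subst (asm) sum_nonneg_eq_0_iff) auto
  then show "v $ i = 0\<^sub>v n $ i" if "i < dim_vec (0\<^sub>v n)" for i
    using that by auto
qed (use assms in auto)

lemma qform_one:
  "v \<in> carrier_vec n \<Longrightarrow> qform (1\<^sub>m n) v = Re (v \<bullet>c v)"
  by (simp add: qform_def)

lemma qform_diag:
  assumes "v \<in> carrier_vec n"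
  shows "qform (mat_diag n (\<lambda>i. complex_of_real (d i))) v = (\<Sum>i<n. d i * (cmod (v $ i))\<^sup>2)"
proof -
  have "(mat_diag n (\<lambda>i. complex_of_real (d i)) *\<^sub>v v) $ i = d i * v $ i" if "i < n" for i
  proof -
    have "(if i = j then complex_of_real (d j) else 0) * v $ j
        = (if i = j then complex_of_real (d j) * v $ j else 0)" for j
      by simp
    then show ?thesis
      using that assms by (simp add: scalar_prod_def atLeast0LessThan mat_diag_def)
  qed
  then have "(mat_diag n (\<lambda>i. complex_of_real (d i)) *\<^sub>v v) \<bullet>c v
      = (\<Sum>i<n. complex_of_real (d i) * (v $ i * cnj (v $ i)))"
    using assms by (auto simp: scalar_prod_def atLeast0LessThan mult.assoc intro!: sum.cong)
  then show ?thesis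
    by (simp add: qform_def complex_mult_cnj cmod_power2)
qed

section \<open>The Loewner order\<close>

lemma hermitian_matD:
  "hermitian_mat n A \<Longrightarrow> A \<in> carrier_mat n n" "hermitian_mat n A \<Longrightarrow> mat_adjoint A = A"
  "hermitian_mat n A \<Longrightarrow> dim_row A = n" "hermitian_mat n A \<Longrightarrow> dim_col A = n"
  by (auto simp: hermitian_mat_def)

lemma hermitian_congruence:
  assumes "hermitian_mat m A" "S \<in> carrier_mat n m"
  shows "hermitian_mat n (S * A * mat_adjoint S)"
proof -
  have "dim_row A = m" "dim_col A = m" "mat_adjoint A = A" "dim_row S = n" "dim_col S = m"
    using assms hermitian_matD by auto
  then show ?thesis
    unfolding hermitian_mat_def by (auto simp: mat_adjoint_simps mat_ring)
qed

lemma hermitian_arith: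
  assumes "hermitian_mat n A" "hermitian_mat n B"
  shows "hermitian_mat n (A + B)" "hermitian_mat n (A - B)"
  using assms hermitian_matD[OF assms(1)] hermitian_matD[OF assms(2)]
  by (auto simp: hermitian_mat_def mat_adjoint_simps minus_carrier_mat)

lemma hermitian_smult: "hermitian_mat n A \<Longrightarrow> hermitian_mat n (complex_of_real c \<cdot>\<^sub>m A)"
  by (auto simp: hermitian_mat_def mat_adjoint_simps)

lemma hermitian_one [simp]: "hermitian_mat n (1\<^sub>m n)"
  and hermitian_zero [simp]: "hermitian_mat n (0\<^sub>m n n)"
  by (auto simp: hermitian_mat_def)

lemma psd_mat_iff: "psd_mat n A \<longleftrightarrow> hermitian_mat n A \<and> (\<forall>v\<in>carrier_vec n. 0 \<le> qform A v)"
  by (simp add: psd_mat_def qform_def)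

lemma pd_mat_iff:
  "pd_mat n A \<longleftrightarrow> hermitian_mat n A \<and> (\<forall>v\<in>carrier_vec n. v \<noteq> 0\<^sub>v n \<longrightarrow> 0 < qform A v)"
  by (simp add: pd_mat_def qform_def)

lemma loewner_ge_iff:
  "loewner_ge n A B \<longleftrightarrow> hermitian_mat n A \<and> hermitian_mat n B \<and>
     (\<forall>v\<in>carrier_vec n. qform B v \<le> qform A v)"
proof -
  have "qform (A - B) v = qform A v - qform B v"
    if "hermitian_mat n A" "hermitian_mat n B" "v \<in> carrier_vec n" for v
    by (rule qform_arith(2)) (use that hermitian_matD in auto)
  then show ?thesis
    by (auto simp: loewner_ge_def psd_mat_iff hermitian_arith)
qed

lemma loewner_refl: "hermitian_mat n A \<Longrightarrow> loewner_ge n A A"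
  by (simp add: loewner_ge_iff)

lemma loewner_trans: "loewner_ge n A B \<Longrightarrow> loewner_ge n B C \<Longrightarrow> loewner_ge n A C"
  by (force simp: loewner_ge_iff)

lemma loewner_congruence:
  assumes "loewner_ge m A B" "S \<in> carrier_mat n m"
  shows "loewner_ge n (S * A * mat_adjoint S) (S * B * mat_adjoint S)"
proof -
  have "mat_adjoint S *\<^sub>v v \<in> carrier_vec m" if "v \<in> carrier_vec n" for v
    by (rule mult_mat_vec_carrier[of _ m n]) (use assms(2) that in auto)
  then show ?thesis
    using assms by (auto simp: loewner_ge_iff hermitian_congruence hermitian_matD qform_congruence[of S n m])
qed

lemma loewner_add:
  "loewner_ge n A B \<Longrightarrow> loewner_ge n C D \<Longrightarrow> loewner_ge n (A + C) (B + D)"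
proof -
  assume H: "loewner_ge n A B" "loewner_ge n C D"
  then have c: "hermitian_mat n A" "hermitian_mat n B" "hermitian_mat n C" "hermitian_mat n D"
    by (auto simp: loewner_ge_iff)
  show "loewner_ge n (A + C) (B + D)"
    using H c qform_arith(1)[OF c(1,3)[THEN hermitian_matD(1)]]
      qform_arith(1)[OF c(2,4)[THEN hermitian_matD(1)]]
    by (simp add: loewner_ge_iff hermitian_arith add_mono)
qed

lemma loewner_smult:
  assumes "loewner_ge n A B" "0 \<le> c"
  shows "loewner_ge n (complex_of_real c \<cdot>\<^sub>m A) (complex_of_real c \<cdot>\<^sub>m B)"
proof -
  have h: "hermitian_mat n A" "hermitian_mat n B" using assms by (auto simp: loewner_ge_iff)
  show ?thesis
    using assms qform_smult[OF hermitian_matD(1)[OF h(1)]] qform_smult[OF hermitian_matD(1)[OF h(2)]]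
    by (simp add: loewner_ge_iff hermitian_smult mult_left_mono)
qed

lemma psd_mat_congruence:
  "psd_mat m A \<Longrightarrow> S \<in> carrier_mat n m \<Longrightarrow> psd_mat n (S * A * mat_adjoint S)"
proof -
  assume A: "psd_mat m A" and S: "S \<in> carrier_mat n m"
  have "mat_adjoint S *\<^sub>v v \<in> carrier_vec m" if "v \<in> carrier_vec n" for v
    by (rule mult_mat_vec_carrier[of _ m n]) (use S that in auto)
  then show ?thesis
    using A S by (auto simp: psd_mat_iff hermitian_congruence hermitian_matD qform_congruence[of S n m])
qed

lemma psd_imp_hermitian: "psd_mat n A \<Longrightarrow> hermitian_mat n A"
  by (simp add: psd_mat_def)

lemma psd_add:
  assumes "psd_mat n A" "psd_mat n B"
  shows "psd_mat n (A + B)"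
  using assms qform_arith(1)[OF assms[THEN psd_imp_hermitian, THEN hermitian_matD(1)]]
  by (auto simp: psd_mat_iff hermitian_arith)

lemma psd_loewner: "psd_mat n A \<Longrightarrow> loewner_ge n B A \<Longrightarrow> psd_mat n B"
  by (force simp: psd_mat_iff loewner_ge_iff)

lemma pd_loewner: "pd_mat n A \<Longrightarrow> loewner_ge n B A \<Longrightarrow> pd_mat n B"
  by (force simp: pd_mat_iff loewner_ge_iff)

lemma qform_zero_vec [simp]: "A \<in> carrier_mat n n \<Longrightarrow> qform A (0\<^sub>v n) = 0"
  by (simp add: qform_def)

lemma pd_imp_psd: "pd_mat n A \<Longrightarrow> psd_mat n A"
  unfolding pd_mat_iff psd_mat_iff using qform_zero_vec hermitian_matD(1)
  by (metis less_eq_real_def)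

lemma psd_gram: 
  assumes "S \<in> carrier_mat n m"
  shows "psd_mat n (S * mat_adjoint S)"
proof -
  have "psd_mat m (1\<^sub>m m)"
    by (simp add: psd_mat_iff qform_one Re_cscalar_prod_ge_0)
  from psd_mat_congruence[OF this assms] show ?thesis using assms by simp
qed

section \<open>The spectral theorem\<close>

lemma unitary_matD:
  assumes "unitary_mat n U"
  shows "U \<in> carrier_mat n n" "dim_row U = n" "dim_col U = n"
    "U * mat_adjoint U = 1\<^sub>m n" "mat_adjoint U * U = 1\<^sub>m n"
  using assms by (auto simp: unitary_mat_def)

lemma unitary_cancel:
  assumes "unitary_mat n U" "dim_row X = n"
  shows "mat_adjoint U * (U * X) = X" "U * (mat_adjoint U * X) = X"
  using unitary_matD[OF assms(1)] assms(2) by (simp_all flip: mat_mult_assoc)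

lemma unitary_mult:
  assumes "unitary_mat n U" "unitary_mat n V"
  shows "unitary_mat n (U * V)"
  using unitary_matD[OF assms(1)] unitary_matD[OF assms(2)] unitary_cancel[OF assms(1)]
    unitary_cancel[OF assms(2)]
  by (simp add: unitary_mat_def mat_adjoint_simps mat_ring)

lemma mat_left_inverse_imp_right:
  fixes U :: "complex mat"
  assumes "U \<in> carrier_mat n n" "mat_adjoint U * U = 1\<^sub>m n"
  shows "unitary_mat n U"
  unfolding unitary_mat_def
  using assms mat_mult_left_right_inverse[of "mat_adjoint U" n U] by auto

text \<open>Gram-Schmidt, started from a basis whose first member is \<open>v\<close>, leaves that member in place; it
remains to divide the orthogonal vectors by their lengths \<open>s i\<close>.\<close>

lemma unitary_with_first_column:
  fixes v :: "complex vec"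
  assumes v: "v \<in> carrier_vec n" and v0: "v \<noteq> 0\<^sub>v n" and n: "n \<noteq> 0"
  shows "\<exists>U c. unitary_mat n U \<and> col U 0 = c \<cdot>\<^sub>v v"
proof -
  interpret cof_vec_space n "TYPE(complex)" .
  define b where "b = basis_completion v"
  define ws where "ws = gram_schmidt n b"
  from basis_completion[OF v v0, folded b_def]
  have dist_b: "distinct b" and indep: "\<not> lin_dep (set b)" and b: "set b \<subseteq> carrier_vec n"
    and hdb: "hd b = v" and len_b: "length b = n" by auto
  from hdb len_b n obtain vs where bv: "b = v # vs" by (cases b, auto)
  from gram_schmidt_result[OF b dist_b indep refl, folded ws_def]
  have ws: "set ws \<subseteq> carrier_vec n" "corthogonal ws" "length ws = n"
    by (auto simp: len_b)
  from gram_schmidt_hd[OF v, of vs, folded bv] have hdws: "hd ws = v"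
    unfolding ws_def .
  have wsi: "ws ! i \<in> carrier_vec n" if "i < n" for i
    using ws that by auto
  define s where "s i = sqrt (Re (ws ! i \<bullet>c ws ! i))" for i
  have real: "ws ! i \<bullet>c ws ! i = complex_of_real (s i * s i)" for i
  proof -
    have "Im (ws ! i \<bullet>c ws ! i) = 0" by (simp add: scalar_prod_def mult.commute)
    then show ?thesis
      using Re_cscalar_prod_ge_0[of "ws ! i"] by (simp add: complex_eq_iff s_def)
  qed
  have s0: "s i \<noteq> 0" if "i < n" for i
    using corthogonalD[OF ws(2), of i i] that ws(3) real[of i] by auto
  define U where "U = mat n n (\<lambda>(i, j). (ws ! j) $ i / complex_of_real (s j))"
  have U: "U \<in> carrier_mat n n" by (simp add: U_def)
  have "mat_adjoint U * U = 1\<^sub>m n"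
  proof (rule eq_matI)
    fix i j assume "i < dim_row (1\<^sub>m n)" "j < dim_col (1\<^sub>m n)"
    then have ij: "i < n" "j < n" by auto
    have "(mat_adjoint U * U) $$ (i, j)
        = (\<Sum>k<n. cnj (ws ! i $ k) * (ws ! j $ k)) / complex_of_real (s i * s j)"
      using U ij
      by (auto simp: scalar_prod_def atLeast0LessThan sum_divide_distrib U_def intro!: sum.cong)
    also have "(\<Sum>k<n. cnj (ws ! i $ k) * (ws ! j $ k)) = ws ! j \<bullet>c ws ! i"
      using wsi[OF ij(1)] wsi[OF ij(2)]
      by (auto simp: scalar_prod_def atLeast0LessThan intro!: sum.cong)
    also have "(ws ! j \<bullet>c ws ! i) / complex_of_real (s i * s j) = (if i = j then 1 else 0)"
      using corthogonalD[OF ws(2), of j i] ij ws(3) real[of i] s0[OF ij(1)] by auto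
    finally show "(mat_adjoint U * U) $$ (i, j) = 1\<^sub>m n $$ (i, j)" using ij by simp
  qed (use U in auto)
  then have "unitary_mat n U" using U mat_left_inverse_imp_right by blast
  moreover have "col U 0 = (1 / complex_of_real (s 0)) \<cdot>\<^sub>v v"
  proof -
    have "ws ! 0 = v" using hdws ws(3) n by (metis hd_conv_nth length_0_conv)
    then show ?thesis using v n by (intro eq_vecI) (auto simp: U_def)
  qed
  ultimately show ?thesis by blast
qed

lemma complex_eigenvector_exists:
  fixes A :: "complex mat"
  assumes "A \<in> carrier_mat n n" "n \<noteq> 0"
  shows "\<exists>v e. v \<in> carrier_vec n \<and> v \<noteq> 0\<^sub>v n \<and> A *\<^sub>v v = e \<cdot>\<^sub>v v"
proof -
  have "degree (char_poly A) \<noteq> 0" using degree_monic_char_poly[OF assms(1)] assms(2) by simp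
  then have "\<not> constant (poly (char_poly A))" by (simp add: constant_degree)
  then obtain e where "poly (char_poly A) e = 0" using fundamental_theorem_of_algebra by blast
  then have "eigenvalue A e" using eigenvalue_root_char_poly[OF assms(1)] by simp
  then show ?thesis using assms(1) by (auto simp: eigenvalue_def eigenvector_def)
qed

text \<open>Splitting off one eigenvector turns a Hermitian matrix into such a direct sum of a number and a
smaller matrix, which is the induction step of the spectral theorem.\<close>

definition bordered :: "nat \<Rightarrow> complex \<Rightarrow> complex mat \<Rightarrow> complex mat" where
  "bordered n c B = four_block_mat (c \<cdot>\<^sub>m 1\<^sub>m 1) (0\<^sub>m 1 n) (0\<^sub>m n 1) B"

lemma bordered_mult:
  assumes "B \<in> carrier_mat n n" "C \<in> carrier_mat n n"
  shows "bordered n b B * bordered n c C = bordered n (b * c) (B * C)"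
proof -
  have "bordered n b B * bordered n c C
      = four_block_mat (b \<cdot>\<^sub>m 1\<^sub>m 1 * (c \<cdot>\<^sub>m 1\<^sub>m 1) + 0\<^sub>m 1 n * 0\<^sub>m n 1) (b \<cdot>\<^sub>m 1\<^sub>m 1 * 0\<^sub>m 1 n + 0\<^sub>m 1 n * C)
         (0\<^sub>m n 1 * (c \<cdot>\<^sub>m 1\<^sub>m 1) + B * 0\<^sub>m n 1) (0\<^sub>m n 1 * 0\<^sub>m 1 n + B * C)"
    unfolding bordered_def
    by (rule mult_four_block_mat[of _ 1 1 _ n _ n]) (use assms in auto)
  also have "\<dots> = bordered n (b * c) (B * C)"
    unfolding bordered_def using assms
    by (intro arg_cong4[where f = four_block_mat] eq_matI) (auto simp: scalar_prod_def)
  finally show ?thesis .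
qed

lemma bordered_adjoint:
  "B \<in> carrier_mat n n \<Longrightarrow> mat_adjoint (bordered n c B) = bordered n (cnj c) (mat_adjoint B)"
  by (rule eq_matI) (auto simp: bordered_def four_block_mat_def Let_def)

lemma bordered_carrier: "B \<in> carrier_mat n n \<Longrightarrow> bordered n c B \<in> carrier_mat (Suc n) (Suc n)"
  by (auto simp: bordered_def four_block_mat_def Let_def)

lemma bordered_one: "bordered n 1 (1\<^sub>m n) = 1\<^sub>m (Suc n)"
  by (rule eq_matI) (auto simp: bordered_def four_block_mat_def Let_def)

lemma bordered_diag: "bordered n (d 0) (mat_diag n (\<lambda>i. d (Suc i))) = mat_diag (Suc n) d"
  by (rule eq_matI) (auto simp: bordered_def four_block_mat_def Let_def mat_diag_def)

text \<open>Induction on the dimension. A unitary matrix whose first column is an eigenvector turns \<open>A\<close> into a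
Hermitian matrix \<open>B\<close> whose first column vanishes below the diagonal. By symmetry the first row
vanishes too and the eigenvalue \<open>e\<close> is real, so that \<open>B\<close> is a direct sum.\<close>

theorem hermitian_diagonalization:
  "hermitian_mat n A \<Longrightarrow>
   \<exists>U d. unitary_mat n U \<and> A = U * mat_diag n (\<lambda>i. complex_of_real (d i)) * mat_adjoint U"
proof (induction n arbitrary: A)
  case 0
  then have "A = 1\<^sub>m 0 * mat_diag 0 (\<lambda>i. complex_of_real 0) * mat_adjoint (1\<^sub>m 0)"
    by (intro eq_matI) (auto simp: hermitian_mat_def)
  moreover have "unitary_mat 0 (1\<^sub>m 0)" by (simp add: unitary_mat_def)
  ultimately show ?case by fast
next
  case (Suc n)
  note A = hermitian_matD[OF Suc.prems]
  obtain v e where v: "v \<in> carrier_vec (Suc n)" "v \<noteq> 0\<^sub>v (Suc n)" and ev: "A *\<^sub>v v = e \<cdot>\<^sub>v v"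
    using complex_eigenvector_exists[OF A(1)] by auto
  obtain U c where U: "unitary_mat (Suc n) U" and col: "col U 0 = c \<cdot>\<^sub>v v"
    using unitary_with_first_column[OF v] by auto
  note Ud = unitary_matD[OF U]
  define B where "B = mat_adjoint U * A * U"
  have B: "hermitian_mat (Suc n) B"
    using hermitian_congruence[OF Suc.prems, of "mat_adjoint U" "Suc n"] Ud by (simp add: B_def)
  note Bd = hermitian_matD[OF B]
  have colB: "col B 0 = e \<cdot>\<^sub>v unit_vec (Suc n) 0"
  proof -
    have "col B 0 = mat_adjoint U * A *\<^sub>v col U 0"
      unfolding B_def using A Ud by (intro col_mult2) auto
    also have "\<dots> = mat_adjoint U *\<^sub>v (A *\<^sub>v col U 0)"
      using A Ud v by (intro assoc_mult_mat_vec[of _ "Suc n" "Suc n" _ "Suc n"]) (auto simp: col)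
    also have "A *\<^sub>v col U 0 = e \<cdot>\<^sub>v col U 0"
      using A v by (simp add: col mult_mat_vec[OF A(1)] ev smult_smult_assoc mult.commute)
    also have "mat_adjoint U *\<^sub>v (e \<cdot>\<^sub>v col U 0) = e \<cdot>\<^sub>v (mat_adjoint U *\<^sub>v col U 0)"
      using Ud v by (intro mult_mat_vec[of _ "Suc n" "Suc n"]) (auto simp: col)
    also have "mat_adjoint U *\<^sub>v col U 0 = col (mat_adjoint U * U) 0"
      using Ud by (intro col_mult2[symmetric, of _ "Suc n" "Suc n" _ "Suc n"]) auto
    finally show ?thesis using Ud by simp
  qed
  have B0: "B $$ (i, 0) = (if i = 0 then e else 0)" if "i < Suc n" for i
    using arg_cong[OF colB, of "\<lambda>w. w $ i"] that Bd by (auto simp: unit_vec_def)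
  have B0': "B $$ (0, i) = cnj (B $$ (i, 0))" if "i < Suc n" for i
    by (metis Bd(2,3,4) index_mat_adjoint that zero_less_Suc)
  have e: "e = complex_of_real (Re e)"
    using B0[of 0] B0'[of 0] by (simp add: complex_eq_iff)
  define B' where "B' = mat n n (\<lambda>(i, j). B $$ (Suc i, Suc j))"
  have "hermitian_mat n B'"
    unfolding hermitian_mat_def
  proof
    show "mat_adjoint B' = B'"
    proof (rule eq_matI)
      fix i j assume "i < dim_row B'" "j < dim_col B'"
      then have ij: "i < n" "j < n" by (auto simp: B'_def)
      then have "B $$ (Suc i, Suc j) = cnj (B $$ (Suc j, Suc i))"
        by (metis Bd(2,3,4) index_mat_adjoint Suc_mono)
      then show "mat_adjoint B' $$ (i, j) = B' $$ (i, j)"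
        using ij by (simp add: B'_def)
    qed (auto simp: B'_def)
  qed (auto simp: B'_def)
  then obtain V d where V: "unitary_mat n V"
    and B': "B' = V * mat_diag n (\<lambda>i. complex_of_real (d i)) * mat_adjoint V"
    using Suc.IH by blast
  note Vd = unitary_matD[OF V]
  define V' where "V' = bordered n 1 V"
  define d' where "d' = case_nat (Re e) d"
  have V': "unitary_mat (Suc n) V'"
    using Vd by (simp add: V'_def unitary_mat_def bordered_carrier bordered_adjoint bordered_mult
        bordered_one)
  have "cnj e = e" by (subst (1 2) e) simp
  then have "B = bordered n e B'"
    using Bd B0 B0'
    by (intro eq_matI) (auto simp: bordered_def four_block_mat_def Let_def B'_def)
  also have "\<dots> = V' * bordered n e (mat_diag n (\<lambda>i. complex_of_real (d i))) * mat_adjoint V'"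
    using Vd by (simp add: V'_def B' bordered_adjoint bordered_mult)
  also have "bordered n e (mat_diag n (\<lambda>i. complex_of_real (d i)))
      = mat_diag (Suc n) (\<lambda>i. complex_of_real (d' i))"
    using bordered_diag[of n "\<lambda>i. complex_of_real (d' i)"] e by (simp add: d'_def)
  finally have BV: "B = V' * mat_diag (Suc n) (\<lambda>i. complex_of_real (d' i)) * mat_adjoint V'" .
  have "A = U * B * mat_adjoint U"
    unfolding B_def using Ud A unitary_cancel[OF U] by (simp add: mat_ring)
  also have "\<dots> = (U * V') * mat_diag (Suc n) (\<lambda>i. complex_of_real (d' i)) * mat_adjoint (U * V')"
    using Ud unitary_matD[OF V'] by (simp add: BV mat_ring mat_adjoint_simps)
  finally show ?case using unitary_mult[OF U V'] by blast
qed

section \<open>Functional calculus\<close>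

text \<open>Written in the two eigenbases, \<open>S\<close> becomes a matrix \<open>W\<close> with \<open>d\<^sub>i W\<^sub>i\<^sub>j = W\<^sub>i\<^sub>j c\<^sub>j\<close>. Hence \<open>W\<^sub>i\<^sub>j\<close> can differ
from zero only where \<open>d\<^sub>i = c\<^sub>j\<close>, and there \<open>f\<close> takes the same value on both sides.\<close>

lemma diagonalization_intertwine:
  assumes U: "unitary_mat n U" and V: "unitary_mat m V" and S: "S \<in> carrier_mat n m"
    and eq: "(U * mat_diag n (\<lambda>i. complex_of_real (d i)) * mat_adjoint U) * S
      = S * (V * mat_diag m (\<lambda>i. complex_of_real (c i)) * mat_adjoint V)"
  shows "(U * mat_diag n (\<lambda>i. complex_of_real (f (d i))) * mat_adjoint U) * S
      = S * (V * mat_diag m (\<lambda>i. complex_of_real (f (c i))) * mat_adjoint V)"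
proof -
  note Ud = unitary_matD[OF U] and Vd = unitary_matD[OF V]
  have Sd: "dim_row S = n" "dim_col S = m" using S by auto
  let ?D = "\<lambda>f. mat_diag n (\<lambda>i. complex_of_real (f (d i)))"
  let ?C = "\<lambda>f. mat_diag m (\<lambda>i. complex_of_real (f (c i)))"
  define W where "W = mat_adjoint U * S * V"
  have W: "W \<in> carrier_mat n m" using S Ud Vd by (auto simp: W_def intro!: carrier_matI)
  have S_eq: "S = U * W * mat_adjoint V"
    using Ud Vd Sd unitary_cancel[OF U] by (simp add: W_def mat_ring)
  have "?D (\<lambda>x. x) * W = mat_adjoint U * ((U * ?D (\<lambda>x. x) * mat_adjoint U) * S) * V"
    using Ud Vd Sd unitary_cancel[OF U] by (simp add: W_def mat_ring)
  also have "\<dots> = W * ?C (\<lambda>x. x)"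
    unfolding eq using Ud Vd Sd by (simp add: W_def mat_ring)
  finally have DW: "?D (\<lambda>x. x) * W = W * ?C (\<lambda>x. x)" .
  have "?D f * W = W * ?C f"
  proof (rule eq_matI)
    fix i j assume "i < dim_row (W * ?C f)" "j < dim_col (W * ?C f)"
    then have ij: "i < n" "j < m" using W by auto
    have "complex_of_real (d i) * W $$ (i, j) = W $$ (i, j) * complex_of_real (c j)"
      using arg_cong[OF DW, of "\<lambda>M. M $$ (i, j)"] W ij
      by (simp add: mat_diag_mult_left[OF W] mat_diag_mult_right[OF W])
    then have "W $$ (i, j) = 0 \<or> d i = c j" by auto
    then show "(?D f * W) $$ (i, j) = (W * ?C f) $$ (i, j)"
      using W ij by (auto simp: mat_diag_mult_left[OF W] mat_diag_mult_right[OF W])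
  qed (use W in auto)
  then have "U * (?D f * W) * mat_adjoint V = U * (W * ?C f) * mat_adjoint V" by simp
  moreover have "U * (?D f * W) * mat_adjoint V = (U * ?D f * mat_adjoint U) * S"
    using Ud Vd Sd unitary_cancel[OF U] by (simp add: W_def mat_ring)
  moreover have "U * (W * ?C f) * mat_adjoint V = S * (V * ?C f * mat_adjoint V)"
    using Ud Vd Sd unitary_cancel[OF U] by (simp add: W_def mat_ring)
  ultimately show ?thesis by simp
qed

text \<open>Two diagonalizations of the same matrix are intertwined by the identity, so the functional calculus
does not depend on the one that is chosen.\<close>

lemma fun_calc_eqI:
  assumes U: "unitary_mat n U"
    and A: "A = U * mat_diag n (\<lambda>i. complex_of_real (d i)) * mat_adjoint U"
  shows "fun_calc f A = U * mat_diag n (\<lambda>i. complex_of_real (f (d i))) * mat_adjoint U"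
proof -
  have n: "dim_row A = n" using unitary_matD[OF U] A by simp
  show ?thesis
    unfolding fun_calc_def n
  proof (rule the_equality)
    show "\<exists>V c. unitary_mat n V \<and> A = V * mat_diag n (\<lambda>i. complex_of_real (c i)) * mat_adjoint V \<and>
      U * mat_diag n (\<lambda>i. complex_of_real (f (d i))) * mat_adjoint U
        = V * mat_diag n (\<lambda>i. complex_of_real (f (c i))) * mat_adjoint V"
      using U A by blast
  next
    fix B
    assume "\<exists>V c. unitary_mat n V \<and> A = V * mat_diag n (\<lambda>i. complex_of_real (c i)) * mat_adjoint V \<and>
      B = V * mat_diag n (\<lambda>i. complex_of_real (f (c i))) * mat_adjoint V"
    then obtain V c where V: "unitary_mat n V"
      and AV: "A = V * mat_diag n (\<lambda>i. complex_of_real (c i)) * mat_adjoint V"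
      and B: "B = V * mat_diag n (\<lambda>i. complex_of_real (f (c i))) * mat_adjoint V" by blast
    have "B * 1\<^sub>m n = 1\<^sub>m n * (U * mat_diag n (\<lambda>i. complex_of_real (f (d i))) * mat_adjoint U)"
      unfolding B
      by (rule diagonalization_intertwine[OF V U])
        (use unitary_matD[OF U] in \<open>simp_all add: A flip: AV\<close>)
    then show "B = U * mat_diag n (\<lambda>i. complex_of_real (f (d i))) * mat_adjoint U"
      using unitary_matD[OF U] unitary_matD[OF V] by (simp add: B)
  qed
qed

lemma qform_eigenvector:
  assumes U: "unitary_mat n U" and i: "i < n"
  shows "qform (U * mat_diag n (\<lambda>i. complex_of_real (d i)) * mat_adjoint U) (U *\<^sub>v unit_vec n i) = d i"
    and "U *\<^sub>v unit_vec n i \<noteq> 0\<^sub>v n"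
proof -
  note Ud = unitary_matD[OF U]
  have UU: "mat_adjoint U *\<^sub>v (U *\<^sub>v unit_vec n i) = unit_vec n i"
    using Ud by (subst assoc_mult_mat_vec[of _ n n _ n, symmetric]) auto
  have "(\<Sum>j<n. d j * (cmod (unit_vec n i $ j))\<^sup>2) = (\<Sum>j<n. if j = i then d j else 0)"
    using i by (intro sum.cong) (auto simp: unit_vec_def)
  also have "\<dots> = d i" using i by simp
  finally show "qform (U * mat_diag n (\<lambda>i. complex_of_real (d i)) * mat_adjoint U) (U *\<^sub>v unit_vec n i) = d i"
    using Ud by (subst qform_congruence[of _ n n]) (auto simp: UU qform_diag)
  have zero: "mat_adjoint U *\<^sub>v 0\<^sub>v n = 0\<^sub>v n"
    using Ud by (intro eq_vecI) (auto simp: scalar_prod_def)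
  show "U *\<^sub>v unit_vec n i \<noteq> 0\<^sub>v n"
  proof
    assume "U *\<^sub>v unit_vec n i = 0\<^sub>v n"
    then have "unit_vec n i = (0\<^sub>v n :: complex vec)"
      using UU by (simp add: zero)
    then show False using i by (metis index_unit_vec(1) index_zero_vec(1) zero_neq_one)
  qed
qed

lemma hermitian_spectralE:
  assumes "hermitian_mat n A"
  obtains U d where "unitary_mat n U"
    "A = U * mat_diag n (\<lambda>i. complex_of_real (d i)) * mat_adjoint U"
    "\<And>f. fun_calc f A = U * mat_diag n (\<lambda>i. complex_of_real (f (d i))) * mat_adjoint U"
    "psd_mat n A \<Longrightarrow> \<forall>i<n. 0 \<le> d i" "pd_mat n A \<Longrightarrow> \<forall>i<n. 0 < d i"
proof -
  obtain U d where U: "unitary_mat n U"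
    and A: "A = U * mat_diag n (\<lambda>i. complex_of_real (d i)) * mat_adjoint U"
    using hermitian_diagonalization[OF assms] by blast
  have c: "U *\<^sub>v unit_vec n i \<in> carrier_vec n" for i
    using unitary_matD[OF U] by auto
  show ?thesis
  proof (rule that[OF U A fun_calc_eqI[OF U A]])
    show "psd_mat n A \<Longrightarrow> \<forall>i<n. 0 \<le> d i"
      using c qform_eigenvector(1)[OF U, of _ d, folded A] unfolding psd_mat_iff by metis
    show "pd_mat n A \<Longrightarrow> \<forall>i<n. 0 < d i"
      using c qform_eigenvector(1)[OF U, of _ d, folded A] qform_eigenvector(2)[OF U]
      unfolding pd_mat_iff by metis
  qed
qed

text \<open>Since \<open>S\<close> may be rectangular, this one fact replaces polynomial approximation everywhere below: it
gives commutation rules, the functional calculus on reducing subspaces and under isometries, and the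
exchange of \<open>T T\<^sup>*\<close> with \<open>T\<^sup>* T\<close>.\<close>

lemma fun_calc_intertwine:
  assumes "hermitian_mat n A" "hermitian_mat m B" "S \<in> carrier_mat n m" "A * S = S * B"
  shows "fun_calc f A * S = S * fun_calc f B"
proof -
  obtain U d where U: "unitary_mat n U"
    and A: "A = U * mat_diag n (\<lambda>i. complex_of_real (d i)) * mat_adjoint U"
      "fun_calc f A = U * mat_diag n (\<lambda>i. complex_of_real (f (d i))) * mat_adjoint U"
    using hermitian_spectralE[OF assms(1)] by metis
  obtain V c where V: "unitary_mat m V"
    and B: "B = V * mat_diag m (\<lambda>i. complex_of_real (c i)) * mat_adjoint V"
      "fun_calc f B = V * mat_diag m (\<lambda>i. complex_of_real (f (c i))) * mat_adjoint V"
    using hermitian_spectralE[OF assms(2)] by metis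
  show ?thesis
    unfolding A(2) B(2)
    by (rule diagonalization_intertwine[OF U V assms(3)]) (use assms(4) in \<open>simp flip: A(1) B(1)\<close>)
qed

lemma hermitian_diag_congruence:
  "U \<in> carrier_mat n n \<Longrightarrow>
    hermitian_mat n (U * mat_diag n (\<lambda>i. complex_of_real (d i)) * mat_adjoint U)"
  by (intro hermitian_congruence) (auto simp: hermitian_mat_def)

lemma qform_diag_congruence:
  assumes "U \<in> carrier_mat n n" "v \<in> carrier_vec n"
  shows "qform (U * mat_diag n (\<lambda>i. complex_of_real (d i)) * mat_adjoint U) v
    = (\<Sum>i<n. d i * (cmod ((mat_adjoint U *\<^sub>v v) $ i))\<^sup>2)"
proof -
  have w: "mat_adjoint U *\<^sub>v v \<in> carrier_vec n"
    by (rule mult_mat_vec_carrier[of _ n n]) (use assms in auto)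
  show ?thesis
    by (subst qform_congruence[of _ n n]) (use assms w in \<open>auto simp: qform_diag\<close>)
qed

lemma fun_calc_hermitian: "hermitian_mat n A \<Longrightarrow> hermitian_mat n (fun_calc f A)"
  using hermitian_spectralE[of n A] hermitian_diag_congruence unitary_matD(1) by metis

lemma dim_fun_calc:
  assumes "hermitian_mat n A"
  shows "dim_row (fun_calc f A) = n" "dim_col (fun_calc f A) = n" "fun_calc f A \<in> carrier_mat n n"
    "mat_adjoint (fun_calc f A) = fun_calc f A"
  using hermitian_matD[OF fun_calc_hermitian[OF assms]] by auto

lemma fun_calc_cong_psd:
  assumes "psd_mat n A" "\<And>x. 0 \<le> x \<Longrightarrow> f x = g x"
  shows "fun_calc f A = fun_calc g A"
proof -
  from psd_imp_hermitian[OF assms(1)] obtain U d where "\<forall>i<n. 0 \<le> d i"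
    and *: "\<And>f. fun_calc f A = U * mat_diag n (\<lambda>i. complex_of_real (f (d i))) * mat_adjoint U"
    using hermitian_spectralE assms(1) by metis
  then have "mat_diag n (\<lambda>i. complex_of_real (f (d i))) = mat_diag n (\<lambda>i. complex_of_real (g (d i)))"
    by (intro eq_matI) (auto simp: mat_diag_def assms(2))
  then show ?thesis by (simp add: *)
qed

lemma fun_calc_cong_pd:
  assumes "pd_mat n A" "\<And>x. 0 < x \<Longrightarrow> f x = g x"
  shows "fun_calc f A = fun_calc g A"
proof -
  from psd_imp_hermitian[OF pd_imp_psd[OF assms(1)]] obtain U d where "\<forall>i<n. 0 < d i"
    and *: "\<And>f. fun_calc f A = U * mat_diag n (\<lambda>i. complex_of_real (f (d i))) * mat_adjoint U"
    using hermitian_spectralE assms(1) by metis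
  then have "mat_diag n (\<lambda>i. complex_of_real (f (d i))) = mat_diag n (\<lambda>i. complex_of_real (g (d i)))"
    by (intro eq_matI) (auto simp: mat_diag_def assms(2))
  then show ?thesis by (simp add: *)
qed

lemma fun_calc_mono_fun_psd:
  assumes "psd_mat n A" "\<And>x. 0 \<le> x \<Longrightarrow> f x \<le> g x"
  shows "loewner_ge n (fun_calc g A) (fun_calc f A)"
proof -
  note h = psd_imp_hermitian[OF assms(1)]
  obtain U d where d: "\<forall>i<n. 0 \<le> d i" "unitary_mat n U"
    and *: "\<And>f. fun_calc f A = U * mat_diag n (\<lambda>i. complex_of_real (f (d i))) * mat_adjoint U"
    using hermitian_spectralE[OF h] assms(1) by metis
  then have "qform (fun_calc f A) v \<le> qform (fun_calc g A) v" if "v \<in> carrier_vec n" for v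
    using that unitary_matD(1)[OF d(2)] assms(2)
    by (auto simp: * qform_diag_congruence intro!: sum_mono mult_right_mono)
  then show ?thesis by (simp add: loewner_ge_iff fun_calc_hermitian[OF h])
qed

lemma fun_calc_mono_fun_pd:
  assumes "pd_mat n A" "\<And>x. 0 < x \<Longrightarrow> f x \<le> g x"
  shows "loewner_ge n (fun_calc g A) (fun_calc f A)"
proof -
  have "fun_calc f A = fun_calc (\<lambda>x. min (f x) (g x)) A"
    using assms by (intro fun_calc_cong_pd) (auto simp: min_def)
  then show ?thesis
    by (simp add: fun_calc_mono_fun_psd[OF pd_imp_psd[OF assms(1)]])
qed

lemma fun_calc_spectral_arith:
  assumes "hermitian_mat n A"
  shows fun_calc_mult: "fun_calc f A * fun_calc g A = fun_calc (\<lambda>x. f x * g x) A"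
    and fun_calc_comp: "fun_calc f (fun_calc g A) = fun_calc (\<lambda>x. f (g x)) A"
    and fun_calc_id: "fun_calc (\<lambda>x. x) A = A"
    and fun_calc_const: "fun_calc (\<lambda>x. c) A = complex_of_real c \<cdot>\<^sub>m 1\<^sub>m n"
    and fun_calc_add: "fun_calc f A + fun_calc g A = fun_calc (\<lambda>x. f x + g x) A"
    and fun_calc_smult: "complex_of_real c \<cdot>\<^sub>m fun_calc f A = fun_calc (\<lambda>x. c * f x) A"
proof -
  obtain U d where U: "unitary_mat n U"
    and A: "A = U * mat_diag n (\<lambda>i. complex_of_real (d i)) * mat_adjoint U"
    and *: "\<And>f. fun_calc f A = U * mat_diag n (\<lambda>i. complex_of_real (f (d i))) * mat_adjoint U"
    using hermitian_spectralE[OF assms] by metis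
  note Ud = unitary_matD[OF U]
  have "fun_calc f A * fun_calc g A = U * (mat_diag n (\<lambda>i. complex_of_real (f (d i)))
      * mat_diag n (\<lambda>i. complex_of_real (g (d i)))) * mat_adjoint U"
    unfolding * using Ud unitary_cancel[OF U] by (simp add: mat_ring del: mat_diag_diag)
  then show "fun_calc f A * fun_calc g A = fun_calc (\<lambda>x. f x * g x) A"
    by (simp add: *)
  show "fun_calc f (fun_calc g A) = fun_calc (\<lambda>x. f (g x)) A"
    unfolding *[of "\<lambda>x. f (g x)"] by (rule fun_calc_eqI[OF U *])
  show "fun_calc (\<lambda>x. x) A = A"
    using * A by simp
  have "mat_diag n (\<lambda>i. complex_of_real c) = complex_of_real c \<cdot>\<^sub>m 1\<^sub>m n"
    by (rule eq_matI) (auto simp: mat_diag_def)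
  then show "fun_calc (\<lambda>x. c) A = complex_of_real c \<cdot>\<^sub>m 1\<^sub>m n"
    using Ud by (simp add: * mat_ring)
  have "mat_diag n (\<lambda>i. complex_of_real (f (d i) + g (d i)))
      = mat_diag n (\<lambda>i. complex_of_real (f (d i))) + mat_diag n (\<lambda>i. complex_of_real (g (d i)))"
    by (rule eq_matI) (auto simp: mat_diag_def)
  then show "fun_calc f A + fun_calc g A = fun_calc (\<lambda>x. f x + g x) A"
    unfolding * using Ud by (simp add: mat_ring)
  have "mat_diag n (\<lambda>i. complex_of_real (c * f (d i)))
      = complex_of_real c \<cdot>\<^sub>m mat_diag n (\<lambda>i. complex_of_real (f (d i)))"
    by (rule eq_matI) (auto simp: mat_diag_def)
  then show "complex_of_real c \<cdot>\<^sub>m fun_calc f A = fun_calc (\<lambda>x. c * f x) A"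
    unfolding * using Ud by (simp add: mat_ring)
qed

lemma fun_calc_shift:
  assumes "hermitian_mat n A"
  shows "A + complex_of_real c \<cdot>\<^sub>m 1\<^sub>m n = fun_calc (\<lambda>x. x + c) A"
  using fun_calc_add[OF assms, of "\<lambda>x. x" "\<lambda>x. c"] by (simp add: fun_calc_id[OF assms] fun_calc_const[OF assms])

lemma fun_calc_zero_one:
  shows fun_calc_zero_mat: "f 0 = 0 \<Longrightarrow> fun_calc f (0\<^sub>m n n) = 0\<^sub>m n n"
    and fun_calc_one_mat: "f 1 = 1 \<Longrightarrow> fun_calc f (1\<^sub>m n) = 1\<^sub>m n"
proof -
  have h: "hermitian_mat n (1\<^sub>m n)" by simp
  have z: "0\<^sub>m n n = fun_calc (\<lambda>x. 0) (1\<^sub>m n)"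
    by (simp add: fun_calc_const[OF h])
  have o: "1\<^sub>m n = fun_calc (\<lambda>x. 1) (1\<^sub>m n)"
    by (simp add: fun_calc_const[OF h])
  show "fun_calc f (0\<^sub>m n n) = 0\<^sub>m n n" if "f 0 = 0"
    unfolding z by (simp add: fun_calc_comp[OF h] that)
  show "fun_calc f (1\<^sub>m n) = 1\<^sub>m n" if "f 1 = 1"
    by (subst (1 2) o) (simp add: fun_calc_comp[OF h] that)
qed

lemma fun_calc_psd:
  assumes "psd_mat n A" "\<And>x. 0 \<le> x \<Longrightarrow> 0 \<le> f x"
  shows "psd_mat n (fun_calc f A)"
proof -
  note h = psd_imp_hermitian[OF assms(1)]
  have "psd_mat n (0\<^sub>m n n)"
    by (auto simp: psd_mat_def scalar_prod_def)
  then show ?thesis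
    by (rule psd_loewner)
      (use fun_calc_mono_fun_psd[OF assms(1), of "\<lambda>x. 0" f] assms(2) in \<open>simp add: fun_calc_const[OF h]\<close>)
qed

lemma fun_calc_pd:
  assumes "pd_mat n A" "\<And>x. 0 < x \<Longrightarrow> 0 < f x"
  shows "pd_mat n (fun_calc f A)"
proof -
  note h = psd_imp_hermitian[OF pd_imp_psd[OF assms(1)]]
  obtain U d where d: "\<forall>i<n. 0 < d i" and U: "unitary_mat n U"
    and *: "\<And>f. fun_calc f A = U * mat_diag n (\<lambda>i. complex_of_real (f (d i))) * mat_adjoint U"
    using hermitian_spectralE[OF h] assms(1) by metis
  note Ud = unitary_matD[OF U]
  have "0 < qform (fun_calc f A) v" if v: "v \<in> carrier_vec n" "v \<noteq> 0\<^sub>v n" for v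
  proof -
    define w where "w = mat_adjoint U *\<^sub>v v"
    have w: "w \<in> carrier_vec n"
      unfolding w_def by (rule mult_mat_vec_carrier[of _ n n]) (use v Ud in auto)
    have "U *\<^sub>v w = v"
      unfolding w_def using Ud v by (subst assoc_mult_mat_vec[of _ n n _ n, symmetric]) auto
    moreover have "U *\<^sub>v 0\<^sub>v n = 0\<^sub>v n"
      using Ud by (intro eq_vecI) (auto simp: scalar_prod_def)
    ultimately have "w \<noteq> 0\<^sub>v n" using v by auto
    then obtain i where "i < n" "w $ i \<noteq> 0"
      using w by (metis carrier_vecD eq_vecI index_zero_vec(1) index_zero_vec(2))
    then have "0 < (\<Sum>i<n. f (d i) * (cmod (w $ i))\<^sup>2)"
      using d assms(2)
      by (intro sum_pos2[of _ i]) (auto intro!: mult_nonneg_nonneg less_imp_le[OF assms(2)])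
    then show ?thesis using Ud v by (simp add: * qform_diag_congruence w_def)
  qed
  then show ?thesis by (simp add: pd_mat_iff fun_calc_hermitian[OF h])
qed

lemma pd_shift:
  assumes "psd_mat n A" "0 < c"
  shows "pd_mat n (A + complex_of_real c \<cdot>\<^sub>m 1\<^sub>m n)"
proof -
  note h = psd_imp_hermitian[OF assms(1)]
  have "0 < qform (A + complex_of_real c \<cdot>\<^sub>m 1\<^sub>m n) v" if v: "v \<in> carrier_vec n" "v \<noteq> 0\<^sub>v n" for v
  proof -
    have "0 < Re (v \<bullet>c v)"
      using Re_cscalar_prod_ge_0[of v] Re_cscalar_prod_eq_0[of v n] v by force
    moreover have "qform (A + complex_of_real c \<cdot>\<^sub>m 1\<^sub>m n) v = qform A v + c * Re (v \<bullet>c v)"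
      using hermitian_matD(1)[OF h] v
      by (simp add: qform_arith(1)[of _ n] qform_smult[of _ n] qform_one)
    ultimately show ?thesis using assms v by (auto simp: psd_mat_iff intro!: add_nonneg_pos)
  qed
  moreover have "hermitian_mat n (A + complex_of_real c \<cdot>\<^sub>m 1\<^sub>m n)"
    by (intro hermitian_arith(1) hermitian_smult h hermitian_one)
  ultimately show ?thesis by (simp add: pd_mat_iff)
qed

text \<open>\<open>T\<close> intertwines \<open>T T\<^sup>*\<close> with \<open>T\<^sup>* T\<close>, so once a factor \<open>x\<close> is split off from \<open>f\<close>, the remaining factor
can be moved through \<open>T\<close>.\<close>

lemma fun_calc_gram:
  assumes T: "T \<in> carrier_mat n m" and fg: "\<And>x. 0 \<le> x \<Longrightarrow> f x = g x * x"
  shows "fun_calc f (T * mat_adjoint T) = T * fun_calc g (mat_adjoint T * T) * mat_adjoint T"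
proof -
  have P: "psd_mat n (T * mat_adjoint T)" using psd_gram[OF T] .
  have Q: "psd_mat m (mat_adjoint T * T)" using psd_gram[of "mat_adjoint T" m n] T by simp
  note hP = psd_imp_hermitian[OF P] and hQ = psd_imp_hermitian[OF Q]
  have Td: "dim_row T = n" "dim_col T = m" using T by auto
  have "fun_calc f (T * mat_adjoint T) = fun_calc (\<lambda>x. g x * x) (T * mat_adjoint T)"
    by (rule fun_calc_cong_psd[OF P fg])
  also have "\<dots> = fun_calc g (T * mat_adjoint T) * (T * mat_adjoint T)"
    using fun_calc_mult[OF hP, of g "\<lambda>x. x"] by (simp add: fun_calc_id[OF hP])
  also have "\<dots> = (fun_calc g (T * mat_adjoint T) * T) * mat_adjoint T"
    using Td dim_fun_calc[OF hP] by (simp add: mat_ring)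
  also have "fun_calc g (T * mat_adjoint T) * T = T * fun_calc g (mat_adjoint T * T)"
    by (rule fun_calc_intertwine[OF hP hQ T]) (use Td in \<open>simp add: mat_ring\<close>)
  finally show ?thesis .
qed

text \<open>The matrix stays fixed while the function varies, so convergence can be checked on each eigenvalue.
Limits inside a function of a matrix are brought to this form below, which avoids continuity of the
functional calculus in its matrix argument.\<close>

lemma qform_fun_calc_tendsto:
  assumes "psd_mat n A" "v \<in> carrier_vec n"
    and "\<And>x. 0 \<le> x \<Longrightarrow> ((\<lambda>\<epsilon>. \<phi> \<epsilon> x) \<longlongrightarrow> f x) F"
  shows "((\<lambda>\<epsilon>. qform (fun_calc (\<phi> \<epsilon>) A) v) \<longlongrightarrow> qform (fun_calc f A) v) F"
proof -
  obtain U d where d: "\<forall>i<n. 0 \<le> d i" and U: "unitary_mat n U"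
    and *: "\<And>f. fun_calc f A = U * mat_diag n (\<lambda>i. complex_of_real (f (d i))) * mat_adjoint U"
    using hermitian_spectralE[OF psd_imp_hermitian[OF assms(1)]] assms(1) by metis
  show ?thesis
    using unitary_matD(1)[OF U] assms(2,3) d
    by (auto simp: * qform_diag_congruence intro!: tendsto_intros)
qed

lemma loewner_ge_limit:
  assumes "eventually (\<lambda>\<epsilon>. loewner_ge n (G \<epsilon>) B) F" "F \<noteq> bot" "hermitian_mat n M" "hermitian_mat n B"
    and "\<And>v. v \<in> carrier_vec n \<Longrightarrow> ((\<lambda>\<epsilon>. qform (G \<epsilon>) v) \<longlongrightarrow> qform M v) F"
  shows "loewner_ge n M B"
proof -
  have "qform B v \<le> qform M v" if v: "v \<in> carrier_vec n" for v
    by (rule tendsto_lowerbound[OF assms(5)[OF v] _ assms(2)])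
      (use assms(1) v in \<open>auto elim!: eventually_mono simp: loewner_ge_iff\<close>)
  then show ?thesis using assms by (simp add: loewner_ge_iff)
qed

section \<open>Powers and inverses\<close>

lemma mat_powr_psd: "psd_mat n A \<Longrightarrow> psd_mat n (mat_powr A p)"
  unfolding mat_powr_def by (rule fun_calc_psd) auto

lemma mat_powr_pd: "pd_mat n A \<Longrightarrow> pd_mat n (mat_powr A p)"
  unfolding mat_powr_def by (rule fun_calc_pd) auto

lemma mat_powr_powr: "hermitian_mat n A \<Longrightarrow> mat_powr (mat_powr A a) b = mat_powr A (a * b)"
  unfolding mat_powr_def by (simp add: fun_calc_comp powr_powr)

lemma mat_powr_add: "hermitian_mat n A \<Longrightarrow> mat_powr A a * mat_powr A b = mat_powr A (a + b)"
  unfolding mat_powr_def by (simp add: fun_calc_mult powr_add)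

lemma mat_powr_1: 
  assumes "psd_mat n A" shows "mat_powr A 1 = A"
  using fun_calc_cong_psd[OF assms, of "\<lambda>x. x powr 1" "\<lambda>x. x"] fun_calc_id[OF psd_imp_hermitian[OF assms]]
  by (simp add: mat_powr_def)

lemma mat_powr_0:
  assumes "pd_mat n A" shows "mat_powr A 0 = 1\<^sub>m n"
  using fun_calc_cong_pd[OF assms, of "\<lambda>x. x powr 0" "\<lambda>x. 1"]
    fun_calc_const[OF psd_imp_hermitian[OF pd_imp_psd[OF assms]], of 1]
  by (simp add: mat_powr_def)

text \<open>With \<open>X = A\<^sup>-\<^sup>1\<close> and \<open>Y = B\<^sup>-\<^sup>1\<close>, completing the square gives
\<open>X - Y = (X - Y) A (X - Y) + Y (B - A) Y\<close>, and both summands are positive.\<close>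

lemma loewner_inverse_antimono:
  assumes A: "pd_mat n A" and AB: "loewner_ge n B A"
  shows "loewner_ge n (mat_powr A (-1)) (mat_powr B (-1))"
proof -
  have B: "pd_mat n B" using pd_loewner[OF A AB] .
  define X where "X = mat_powr A (-1)"
  define Y where "Y = mat_powr B (-1)"
  have X: "pd_mat n X" and Y: "pd_mat n Y"
    using A B by (auto simp: X_def Y_def mat_powr_pd)
  note hA = psd_imp_hermitian[OF pd_imp_psd[OF A]] and hB = psd_imp_hermitian[OF pd_imp_psd[OF B]]
  note hX = psd_imp_hermitian[OF pd_imp_psd[OF X]] and hY = psd_imp_hermitian[OF pd_imp_psd[OF Y]]
  note dims = hermitian_matD[OF hA] hermitian_matD[OF hB] hermitian_matD[OF hX] hermitian_matD[OF hY]
  have inv: "A * X = 1\<^sub>m n" "X * A = 1\<^sub>m n" "Y * B = 1\<^sub>m n"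
    using mat_powr_add[OF hA, of 1 "-1"] mat_powr_add[OF hA, of "-1" 1] mat_powr_add[OF hB, of "-1" 1]
      mat_powr_1[OF pd_imp_psd[OF A]] mat_powr_1[OF pd_imp_psd[OF B]]
    by (simp_all add: X_def Y_def mat_powr_0[OF A] mat_powr_0[OF B])
  have inv': "X * (A * Z) = Z" "Y * (B * Z) = Z" if "dim_row Z = n" for Z
    using that dims inv by (simp_all flip: mat_mult_assoc)
  have sq: "(X - Y) * A * mat_adjoint (X - Y) + Y * (B - A) * mat_adjoint Y = X - Y"
  proof -
    have "(X - Y) * A * mat_adjoint (X - Y) + Y * (B - A) * mat_adjoint Y
        = (X - Y - (Y - Y * (A * Y))) + (Y - Y * (A * Y))"
      using dims inv inv' by (simp add: mat_adjoint_simps mat_ring)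
    also have "\<dots> = X - Y"
      using dims by (intro eq_matI) auto
    finally show ?thesis .
  qed
  have "psd_mat n (B - A)" using AB by (simp add: loewner_ge_def)
  then have "psd_mat n (Y * (B - A) * mat_adjoint Y)"
    using dims by (intro psd_mat_congruence) auto
  moreover have "psd_mat n ((X - Y) * A * mat_adjoint (X - Y))"
    using dims by (intro psd_mat_congruence[OF pd_imp_psd[OF A]] minus_carrier_mat) auto
  ultimately have "psd_mat n ((X - Y) * A * mat_adjoint (X - Y) + Y * (B - A) * mat_adjoint Y)"
    by (intro psd_add)
  then have "psd_mat n (X - Y)" unfolding sq .
  then show ?thesis using hX hY by (simp add: loewner_ge_def X_def Y_def)
qed

section \<open>The Loewner-Heinz inequality\<close>

text \<open>The integrand of the classical formula \<open>C x\<^sup>s = \<integral> t\<^sup>s\<^sup>-\<^sup>1 x / (x + t) dt\<close> over \<open>t > 0\<close>; it is extended by zero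
so that the integral can be taken over the whole line.\<close>

definition powr_kernel :: "real \<Rightarrow> real \<Rightarrow> real \<Rightarrow> real" where
  "powr_kernel s x t = (if 0 < t then t powr (s - 1) * (x / (x + t)) else 0)"

lemma powr_kernel_measurable [measurable]: "powr_kernel s x \<in> borel_measurable borel"
  unfolding powr_kernel_def by measurable

text \<open>The integrand is dominated by \<open>t\<^sup>s\<^sup>-\<^sup>1\<close> near zero and by \<open>t\<^sup>s\<^sup>-\<^sup>2\<close> near infinity, and \<open>0 < s < 1\<close> makes both
integrable.\<close>

lemma powr_kernel_1_integrable:
  assumes "0 < s" "s < 1"
  shows "integrable lborel (powr_kernel s 1)"
proof -
  have "set_integrable lebesgue {0..1} (\<lambda>t. t powr (s - 1))"
    by (intro nonnegative_absolutely_integrable_1 integrable_on_powr_from_0) (use assms in auto)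
  then have 1: "integrable lborel (\<lambda>t. indicator {0..1} t * t powr (s - 1))"
    by (simp add: set_integrable_def integrable_completion)
  have "set_integrable lebesgue {1..} (\<lambda>t. t powr (s - 2))"
    using has_integral_powr_to_inf[of "s - 2" 1] assms
    by (intro nonnegative_absolutely_integrable_1) (auto simp: integrable_on_def)
  then have 2: "integrable lborel (\<lambda>t. indicator {1..} t * t powr (s - 2))"
    by (simp add: set_integrable_def integrable_completion)
  show ?thesis
  proof (rule Bochner_Integration.integrable_bound[OF Bochner_Integration.integrable_add[OF 1 2]])
    show "AE t in lborel. norm (powr_kernel s 1 t)
      \<le> norm (indicator {0..1} t * t powr (s - 1) + indicator {1..} t * t powr (s - 2))"
    proof (rule AE_I2)
      fix t :: real
      have "t powr (s - 1) / (1 + t) \<le> t powr (s - 1)" if "0 < t"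
        using that by (simp add: divide_le_eq mult_ge1_I)
      moreover have "t powr (s - 1) / (1 + t) \<le> t powr (s - 2)" if "1 < t"
      proof -
        have "t powr (s - 1) = t powr (s - 2) * t powr 1"
          unfolding powr_add[symmetric] by simp
        then show ?thesis using that by (simp add: divide_le_eq)
      qed
      ultimately show "norm (powr_kernel s 1 t)
        \<le> norm (indicator {0..1} t * t powr (s - 1) + indicator {1..} t * t powr (s - 2))"
        by (auto simp: powr_kernel_def indicator_def)
    qed
  qed simp
qed

text \<open>The substitution \<open>t = x u\<close> reduces the integral for \<open>x\<close> to the one for \<open>1\<close>. The constant
is the latter integral, that is \<open>\<pi> / sin (\<pi> s)\<close>.\<close>

lemma powr_as_resolvent_integral:
  assumes s: "0 < s" "s < 1"
  obtains C where "0 < C"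
    "\<And>x. 0 \<le> x \<Longrightarrow> has_bochner_integral lborel (powr_kernel s x) (C * x powr s)"
proof
  let ?C = "integral\<^sup>L lborel (powr_kernel s 1)"
  note int = powr_kernel_1_integrable[OF s]
  have "1 / 2 \<le> powr_kernel s 1 t" if "0 < t" "t < 1" for t
  proof -
    have "1 = t powr 0" using that by simp
    also have "\<dots> \<le> t powr (s - 1)" using that s by (intro powr_mono') auto
    finally have "1 * (1 / 2) \<le> t powr (s - 1) * (1 / (1 + t))"
      using that by (intro mult_mono) (auto simp: field_simps)
    then show ?thesis using that by (simp add: powr_kernel_def)
  qed
  then have le: "indicator {0<..<1} t * (1 / 2) \<le> powr_kernel s 1 t" for t
    by (auto simp: indicator_def powr_kernel_def)
  have "integrable lborel (\<lambda>t. indicator {0<..<1::real} t * (1 / 2 :: real))"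
    by (intro integrable_mult_left) (simp add: integrable_indicator_iff)
  then have "integral\<^sup>L lborel (\<lambda>t. indicator {0<..<1::real} t * (1 / 2 :: real)) \<le> ?C"
    by (rule integral_mono[OF _ int le])
  then show "0 < ?C" by simp
  show "has_bochner_integral lborel (powr_kernel s x) (?C * x powr s)" if "0 \<le> x" for x
  proof (cases "x = 0")
    case True
    then have "powr_kernel s x = (\<lambda>t. 0)" by (auto simp: powr_kernel_def)
    then show ?thesis using True by (simp add: has_bochner_integral_zero)
  next
    case False
    with that have x: "0 < x" by simp
    have "has_bochner_integral lborel (\<lambda>t. powr_kernel s 1 (0 + (1 / x) * t)) (?C /\<^sub>R \<bar>1 / x\<bar>)"
      using has_bochner_integral_integrable[OF int] x
      by (subst (asm) lborel_has_bochner_integral_real_affine_iff[where c = "1 / x" and t = 0]) auto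
    then have "has_bochner_integral lborel (\<lambda>t. x powr (s - 1) * powr_kernel s 1 ((1 / x) * t))
        (x powr (s - 1) * (?C * x))"
      using x by (intro has_bochner_integral_mult_right) (simp_all add: mult.commute)
    moreover have "x powr (s - 1) * powr_kernel s 1 ((1 / x) * t) = powr_kernel s x t" for t
    proof (cases "0 < t")
      case True
      have "x powr (s - 1) * (t / x) powr (s - 1) = t powr (s - 1)"
        using x True by (simp flip: powr_mult)
      then show ?thesis using x True by (simp add: powr_kernel_def field_simps)
    next
      case False
      then show ?thesis using x by (auto simp: powr_kernel_def zero_less_divide_iff)
    qed
    moreover have "x powr (s - 1) * (?C * x) = ?C * x powr s"
      using x by (simp add: powr_diff)
    ultimately show ?thesis by simp
  qed
qed

text \<open>Because \<open>x / (x + t) = 1 - t (x + t)\<^sup>-\<^sup>1\<close>, this is antitonicity of the inverse.\<close>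

lemma resolvent_mono:
  assumes X: "psd_mat n X" and Y: "psd_mat n Y" and XY: "loewner_ge n X Y" and t: "0 < t"
  shows "loewner_ge n (fun_calc (\<lambda>x. x / (x + t)) X) (fun_calc (\<lambda>x. x / (x + t)) Y)"
proof -
  have rep: "qform (fun_calc (\<lambda>x. x / (x + t)) A) v
      = Re (v \<bullet>c v) - t * qform (mat_powr (A + complex_of_real t \<cdot>\<^sub>m 1\<^sub>m n) (-1)) v"
    if A: "psd_mat n A" and v: "v \<in> carrier_vec n" for A v
  proof -
    note h = psd_imp_hermitian[OF A]
    have "mat_powr (A + complex_of_real t \<cdot>\<^sub>m 1\<^sub>m n) (-1) = fun_calc (\<lambda>x. (x + t) powr (-1)) A"
      by (simp add: mat_powr_def fun_calc_shift[OF h] fun_calc_comp[OF h])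
    moreover have "fun_calc (\<lambda>x. x / (x + t)) A
        = fun_calc (\<lambda>x. 1) A + complex_of_real (- t) \<cdot>\<^sub>m fun_calc (\<lambda>x. (x + t) powr (-1)) A"
      unfolding fun_calc_smult[OF h] fun_calc_add[OF h]
      by (rule fun_calc_cong_psd[OF A]) (use t in \<open>auto simp: powr_minus_divide field_simps\<close>)
    ultimately show ?thesis
      using v dim_fun_calc(3)[OF h]
      by (simp add: qform_arith(1)[of _ n] qform_smult[of _ n] fun_calc_const[OF h] qform_one
          del: of_real_minus)
  qed
  have pd: "pd_mat n (Y + complex_of_real t \<cdot>\<^sub>m 1\<^sub>m n)" using pd_shift[OF Y t] .
  have "loewner_ge n (X + complex_of_real t \<cdot>\<^sub>m 1\<^sub>m n) (Y + complex_of_real t \<cdot>\<^sub>m 1\<^sub>m n)"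
    by (intro loewner_add XY loewner_refl hermitian_smult hermitian_one)
  from loewner_inverse_antimono[OF pd this] show ?thesis
    using t by (auto simp: loewner_ge_iff rep X Y fun_calc_hermitian psd_imp_hermitian)
qed

lemma qform_powr_kernel_integral:
  assumes A: "psd_mat n A" and v: "v \<in> carrier_vec n"
    and C: "\<And>x. 0 \<le> x \<Longrightarrow> has_bochner_integral lborel (powr_kernel s x) (C * x powr s)"
  shows "has_bochner_integral lborel (\<lambda>t. qform (fun_calc (\<lambda>x. powr_kernel s x t) A) v)
    (C * qform (mat_powr A s) v)"
proof -
  obtain U d where d: "\<forall>i<n. 0 \<le> d i" and U: "unitary_mat n U"
    and *: "\<And>f. fun_calc f A = U * mat_diag n (\<lambda>i. complex_of_real (f (d i))) * mat_adjoint U"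
    using hermitian_spectralE[OF psd_imp_hermitian[OF A]] A by metis
  show ?thesis
    unfolding mat_powr_def * qform_diag_congruence[OF unitary_matD(1)[OF U] v] sum_distrib_left
      mult.assoc[symmetric]
    using C d by (intro has_bochner_integral_sum has_bochner_integral_mult_left) auto
qed

text \<open>The quadratic form of \<open>X\<^sup>s\<close> is, up to a positive constant, an integral with positive weights of the
quadratic forms of \<open>x / (x + t)\<close>, each of which is monotone in \<open>X\<close>.\<close>

theorem loewner_heinz:
  assumes X: "psd_mat n X" and Y: "psd_mat n Y" and XY: "loewner_ge n X Y" and s: "0 < s" "s \<le> 1"
  shows "loewner_ge n (mat_powr X s) (mat_powr Y s)"
proof (cases "s = 1")
  case True
  then show ?thesis using XY by (simp add: mat_powr_1[OF X] mat_powr_1[OF Y])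
next
  case False
  with s obtain C where C: "0 < C"
    "\<And>x. 0 \<le> x \<Longrightarrow> has_bochner_integral lborel (powr_kernel s x) (C * x powr s)"
    using powr_as_resolvent_integral[of s] by auto
  have "qform (mat_powr Y s) v \<le> qform (mat_powr X s) v" if v: "v \<in> carrier_vec n" for v
  proof -
    have iX: "has_bochner_integral lborel (\<lambda>t. qform (fun_calc (\<lambda>x. powr_kernel s x t) X) v)
        (C * qform (mat_powr X s) v)"
      and iY: "has_bochner_integral lborel (\<lambda>t. qform (fun_calc (\<lambda>x. powr_kernel s x t) Y) v)
        (C * qform (mat_powr Y s) v)"
      by (auto intro: qform_powr_kernel_integral X Y v C(2))
    have "qform (fun_calc (\<lambda>x. powr_kernel s x t) Y) v \<le> qform (fun_calc (\<lambda>x. powr_kernel s x t) X) v"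
      for t
    proof (cases "0 < t")
      case True
      have eq: "qform (fun_calc (\<lambda>x. powr_kernel s x t) A) v
          = t powr (s - 1) * qform (fun_calc (\<lambda>x. x / (x + t)) A) v" if "psd_mat n A" for A
      proof -
        note h = psd_imp_hermitian[OF that]
        have "fun_calc (\<lambda>x. powr_kernel s x t) A
            = complex_of_real (t powr (s - 1)) \<cdot>\<^sub>m fun_calc (\<lambda>x. x / (x + t)) A"
          using True by (simp add: fun_calc_smult[OF h] powr_kernel_def)
        then show ?thesis using v dim_fun_calc(3)[OF h] by (simp add: qform_smult[of _ n])
      qed
      show ?thesis
        using resolvent_mono[OF X Y XY True] v
        by (auto simp: eq X Y loewner_ge_iff intro!: mult_left_mono)
    next
      case False
      have "fun_calc (\<lambda>x. powr_kernel s x t) A = 0\<^sub>m n n" if "psd_mat n A" for A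
        using False fun_calc_const[OF psd_imp_hermitian[OF that], of 0] by (simp add: powr_kernel_def)
      then show ?thesis using X Y by simp
    qed
    then have "C * qform (mat_powr Y s) v \<le> C * qform (mat_powr X s) v"
      unfolding has_bochner_integral_integral_eq[OF iX, symmetric]
        has_bochner_integral_integral_eq[OF iY, symmetric]
      using iX iY by (intro integral_mono) (auto simp: has_bochner_integral_iff)
    then show ?thesis using C(1) by simp
  qed
  then show ?thesis
    using psd_imp_hermitian[OF mat_powr_psd[OF X]] psd_imp_hermitian[OF mat_powr_psd[OF Y]]
    by (simp add: loewner_ge_iff)
qed

section \<open>Compressions and operator monotone functions\<close>

lemma operator_monotoneD:
  "operator_monotone f \<Longrightarrow> psd_mat n X \<Longrightarrow> psd_mat n Y \<Longrightarrow> loewner_ge n X Y \<Longrightarrow>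
    loewner_ge n (fun_calc f X) (fun_calc f Y)"
  by (simp add: operator_monotone_def)

lemma psd_mat_bounded:
  assumes "psd_mat n A"
  obtains c where "0 < c" "loewner_ge n (complex_of_real c \<cdot>\<^sub>m 1\<^sub>m n) A"
proof -
  note h = psd_imp_hermitian[OF assms]
  obtain U d where d: "\<forall>i<n. 0 \<le> d i" and U: "unitary_mat n U"
    and *: "\<And>f. fun_calc f A = U * mat_diag n (\<lambda>i. complex_of_real (f (d i))) * mat_adjoint U"
    using hermitian_spectralE[OF h] assms by metis
  define c where "c = (\<Sum>i<n. d i) + 1"
  have "d i \<le> c" if "i < n" for i
    using member_le_sum[of i "{..<n}" d] d that by (simp add: c_def)
  then have "qform (fun_calc (\<lambda>x. x) A) v \<le> qform (fun_calc (\<lambda>x. c) A) v" if "v \<in> carrier_vec n" for v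
    using that unitary_matD(1)[OF U]
    by (auto simp: * qform_diag_congruence intro!: sum_mono mult_right_mono)
  then have "loewner_ge n (complex_of_real c \<cdot>\<^sub>m 1\<^sub>m n) A"
    by (simp add: loewner_ge_iff fun_calc_id[OF h] fun_calc_const[OF h] h hermitian_smult)
  moreover have "0 < c" using d by (auto simp: c_def intro!: add_nonneg_pos sum_nonneg)
  ultimately show ?thesis using that by blast
qed

lemma minus_zero_mat [simp]:
  "dim_row A = n \<Longrightarrow> dim_col A = m \<Longrightarrow> A - 0\<^sub>m n m = (A :: complex mat)"
  by (rule eq_matI) auto

lemma projection_matD:
  assumes "projection_mat n E"
  shows "hermitian_mat n E" "E * E = E" "dim_row X = n \<Longrightarrow> E * (E * X) = E * X"
proof -
  show h: "hermitian_mat n E" "E * E = E" using assms by (auto simp: projection_mat_def)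
  show "E * (E * X) = E * X" if "dim_row X = n"
    using that h hermitian_matD[OF h(1)] by (simp flip: mat_mult_assoc)
qed

lemma projection_complement:
  assumes "projection_mat n E"
  defines "F \<equiv> 1\<^sub>m n - E"
  shows "hermitian_mat n F" "F * E = 0\<^sub>m n n" "E * F = 0\<^sub>m n n" "F * F = F" "E + F = 1\<^sub>m n"
proof -
  note Ed = projection_matD[OF assms(1)] and dims = hermitian_matD[OF projection_matD(1)[OF assms(1)]]
  show "hermitian_mat n F" unfolding F_def by (intro hermitian_arith hermitian_one Ed)
  have z: "E - E = 0\<^sub>m n n" using dims by auto
  show FE: "F * E = 0\<^sub>m n n" "E * F = 0\<^sub>m n n"
    unfolding F_def using dims Ed(2) z by (simp_all add: mat_ring)
  show "E + F = 1\<^sub>m n" unfolding F_def by (rule eq_matI) (use dims in auto)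
  have "F * F = F * 1\<^sub>m n - F * E" unfolding F_def using dims by (simp add: mat_ring)
  then show "F * F = F" unfolding FE using dims by (simp add: F_def)
qed

text \<open>\<open>X\<close> is dominated by a matrix \<open>W\<close> that is block diagonal with respect to \<open>E\<close> and \<open>F = 1 - E\<close> and
whose \<open>E\<close>-block is \<open>1 + \<epsilon>\<close> times that of \<open>X\<close>. To obtain it, add to \<open>X\<close> the positive matrix \<open>R X R\<close> with
\<open>R = a E - a\<^sup>-\<^sup>1 F\<close> and \<open>a\<^sup>2 = \<epsilon>\<close>: its off-diagonal blocks are those of \<open>- X\<close>. A multiple of
\<open>F (c - X) F\<close>, which does not touch the \<open>E\<close>-block, replaces the \<open>F\<close>-block by a multiple of \<open>F\<close>.\<close>

lemma compression_pinching:
  assumes E: "projection_mat n E" and X: "psd_mat n X" and \<epsilon>: "0 < \<epsilon>"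
  obtains W where "psd_mat n W" "loewner_ge n W X"
    "W * E = complex_of_real (1 + \<epsilon>) \<cdot>\<^sub>m (E * X * E)"
proof -
  define F where "F = 1\<^sub>m n - E"
  note hE = projection_matD(1)[OF E] and FF = projection_complement[OF E, folded F_def]
  note hX = psd_imp_hermitian[OF X]
  note dE = hermitian_matD[OF hE] and dF = hermitian_matD[OF FF(1)] and dX = hermitian_matD[OF hX]
  obtain c where c: "0 < c" "loewner_ge n (complex_of_real c \<cdot>\<^sub>m 1\<^sub>m n) X"
    using psd_mat_bounded[OF X] by blast
  let ?r = complex_of_real
  define a where "a = sqrt \<epsilon>"
  have a: "a * a = \<epsilon>" "a \<noteq> 0" using \<epsilon> by (auto simp: a_def)
  define R where "R = ?r a \<cdot>\<^sub>m E - ?r (1 / a) \<cdot>\<^sub>m F"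
  have hR: "hermitian_mat n R"
    unfolding R_def by (intro hermitian_arith hermitian_smult hE FF(1))
  note dR = hermitian_matD[OF hR]
  define H where "H = ?r c \<cdot>\<^sub>m 1\<^sub>m n - X"
  have pH: "psd_mat n H" using c(2) by (simp add: loewner_ge_def H_def)
  note dH = hermitian_matD[OF psd_imp_hermitian[OF pH]]
  define D where "D = R * X * mat_adjoint R + ?r (1 + 1 / \<epsilon>) \<cdot>\<^sub>m (F * H * mat_adjoint F)"
  have "psd_mat n (?r (1 + 1 / \<epsilon>) \<cdot>\<^sub>m (F * H * mat_adjoint F))"
    using psd_mat_congruence[OF pH dF(1)] \<epsilon>
    by (auto simp: psd_mat_iff hermitian_smult qform_smult[OF hermitian_matD(1)] simp del: of_real_add)
  then have pD: "psd_mat n D"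
    unfolding D_def by (intro psd_add psd_mat_congruence[OF X dR(1)])
  note dD = hermitian_matD[OF psd_imp_hermitian[OF pD]]
  have RE: "R * E = ?r a \<cdot>\<^sub>m E"
    unfolding R_def using dE dF FF(2) projection_matD(2)[OF E] by (simp add: mat_ring)
  have XE: "X * E = E * X * E + F * X * E"
  proof -
    have "X * E = (E + F) * X * E" unfolding FF(5) using dX by simp
    also have "\<dots> = E * X * E + F * X * E" using dE dF dX by (simp add: mat_ring)
    finally show ?thesis .
  qed
  have "D * E = R * X * (R * E) + ?r (1 + 1 / \<epsilon>) \<cdot>\<^sub>m (F * H * (F * E))"
    unfolding D_def using dR dX dF dH dE by (simp add: mat_ring)
  also have "\<dots> = ?r a \<cdot>\<^sub>m (R * (X * E))"
    unfolding RE FF(2) using dR dX dF dH dE by (simp add: mat_ring)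
  also have "R * (X * E) = ?r a \<cdot>\<^sub>m (E * X * E) - ?r (1 / a) \<cdot>\<^sub>m (F * X * E)"
    unfolding R_def using dX dF dE by (simp add: mat_ring)
  finally have DE: "D * E = ?r a \<cdot>\<^sub>m (?r a \<cdot>\<^sub>m (E * X * E) - ?r (1 / a) \<cdot>\<^sub>m (F * X * E))" .
  have "(X + D) * E = X * E + D * E" using dX dD dE by (simp add: mat_ring)
  also have "\<dots> = E * X * E + F * X * E
      + ?r a \<cdot>\<^sub>m (?r a \<cdot>\<^sub>m (E * X * E) - ?r (1 / a) \<cdot>\<^sub>m (F * X * E))"
    unfolding XE[symmetric] DE ..
  also have "\<dots> = ?r (1 + \<epsilon>) \<cdot>\<^sub>m (E * X * E)"
  proof -
    have aa: "?r a * ?r a = ?r \<epsilon>" "?r a \<noteq> 0" using a by (auto simp flip: of_real_mult)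
    have P: "dim_row (E * X * E) = n" "dim_col (E * X * E) = n" 
      "dim_row (F * X * E) = n" "dim_col (F * X * E) = n" using dE dF dX by auto
    show ?thesis
    proof (rule eq_matI, goal_cases)
      case (1 i j)
      then have ij: "i < n" "j < n" using P by auto
      have alg: "x + y + ?r a * (?r a * x - ?r (1 / a) * y) = ?r (1 + \<epsilon>) * x" for x y :: complex
      proof -
        have "?r a * (?r a * x - ?r (1 / a) * y) = (?r a * ?r a) * x - (?r a * ?r (1 / a)) * y"
          by (simp only: right_diff_distrib mult.assoc)
        also have "\<dots> = ?r \<epsilon> * x - y" using aa by simp
        finally show ?thesis by (simp add: algebra_simps)
      qed
      show ?case
        using ij P alg[of "(E * X * E) $$ (i, j)" "(F * X * E) $$ (i, j)"]
        by (simp del: index_mult_mat(1) of_real_divide of_real_add)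
    qed (use P in auto)
  qed
  finally have WE: "(X + D) * E = ?r (1 + \<epsilon>) \<cdot>\<^sub>m (E * X * E)" .
  moreover have "psd_mat n (X + D)" by (intro psd_add X pD)
  moreover have "loewner_ge n (X + D) X"
    using pD hX psd_imp_hermitian[OF pD]
    by (auto simp: loewner_ge_iff hermitian_arith psd_mat_iff qform_arith(1)[OF dX(1) dD(1)])
  ultimately show ?thesis using that by blast
qed

lemma continuous_scaling_tendsto:
  assumes "continuous_on {0..} f" "0 \<le> x"
  shows "((\<lambda>\<epsilon>. f ((1 + \<epsilon>) * x)) \<longlongrightarrow> f x) (at_right (0::real))"
proof (rule continuous_on_tendsto_compose[OF assms(1)])
  show "((\<lambda>\<epsilon>. (1 + \<epsilon>) * x) \<longlongrightarrow> x) (at_right 0)"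
    by (auto intro!: tendsto_eq_intros)
  show "\<forall>\<^sub>F \<epsilon> in at_right 0. (1 + \<epsilon>) * x \<in> {0..}"
    using assms(2) by (auto simp: eventually_at_right_less intro: eventually_mono[OF eventually_at_right_less[of "0::real"]])
qed (use assms in auto)

text \<open>For the block diagonal \<open>W \<ge> X\<close> of the pinching lemma, \<open>f(W)\<close> is block diagonal too and its \<open>E\<close>-block is
\<open>f\<close> of \<open>(1 + \<epsilon>) E X E\<close>. Monotonicity gives \<open>f(W) \<ge> f(X)\<close>; compress by \<open>E\<close> and let \<open>\<epsilon>\<close> tend to zero.
This is Hansen's inequality for projections.\<close>

theorem operator_monotone_compression:
  assumes f: "operator_monotone f" "continuous_on {0..} f"
    and E: "projection_mat n E" and X: "psd_mat n X"
  shows "loewner_ge n (E * fun_calc f (E * X * E) * E) (E * fun_calc f X * E)"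
proof -
  note hE = projection_matD(1)[OF E] and hX = psd_imp_hermitian[OF X]
  note dE = hermitian_matD[OF hE] and dX = hermitian_matD[OF hX]
  define Y where "Y = E * X * E"
  have Y: "psd_mat n Y" using psd_mat_congruence[OF X dE(1)] dE by (simp add: Y_def)
  note hY = psd_imp_hermitian[OF Y] note dY = hermitian_matD[OF hY]
  have EY: "E * Y = Y" "Y * E = Y"
    unfolding Y_def using dE dX projection_matD(2,3)[OF E] by (simp_all add: mat_ring)
  have step: "loewner_ge n (E * fun_calc (\<lambda>x. f ((1 + \<epsilon>) * x)) Y * mat_adjoint E) (E * fun_calc f X * E)"
    if \<epsilon>: "0 < \<epsilon>" for \<epsilon>
  proof -
    obtain W where W: "psd_mat n W" "loewner_ge n W X" "W * E = complex_of_real (1 + \<epsilon>) \<cdot>\<^sub>m Y"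
      unfolding Y_def using compression_pinching[OF E X \<epsilon>] by blast
    note hW = psd_imp_hermitian[OF W(1)] note dW = hermitian_matD[OF hW]
    let ?Y = "complex_of_real (1 + \<epsilon>) \<cdot>\<^sub>m Y"
    have hY': "hermitian_mat n ?Y" by (intro hermitian_smult hY)
    note dY' = hermitian_matD[OF hY']
    have fY: "fun_calc f ?Y = fun_calc (\<lambda>x. f ((1 + \<epsilon>) * x)) Y"
      using fun_calc_smult[OF hY, of "1 + \<epsilon>" "\<lambda>x. x"] fun_calc_comp[OF hY, of f "\<lambda>x. (1 + \<epsilon>) * x"]
      by (simp add: fun_calc_id[OF hY])
    have EY': "E * ?Y = ?Y" "?Y * E = ?Y"
      using dE dY EY by (simp_all add: mat_mult_smult)
    have "fun_calc f W * E = E * fun_calc f ?Y"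
      by (rule fun_calc_intertwine[OF hW hY' dE(1)]) (simp only: W(3) EY')
    moreover have "fun_calc f ?Y * E = E * fun_calc f ?Y"
      by (rule fun_calc_intertwine[OF hY' hY' dE(1)]) (simp only: EY')
    ultimately have "E * fun_calc f W * E = E * fun_calc f ?Y * E"
      using dE dim_fun_calc[OF hW] dim_fun_calc[OF hY'] by (simp add: mat_mult_assoc)
    moreover have "loewner_ge n (E * fun_calc f W * mat_adjoint E) (E * fun_calc f X * mat_adjoint E)"
      by (rule loewner_congruence[OF operator_monotoneD[OF f(1) W(1) X W(2)] dE(1)])
    ultimately show ?thesis using dE fY by simp
  qed
  have "loewner_ge n (E * fun_calc f Y * mat_adjoint E) (E * fun_calc f X * E)"
  proof (rule loewner_ge_limit[where F = "at_right 0"])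
    show "\<forall>\<^sub>F \<epsilon> in at_right 0.
      loewner_ge n (E * fun_calc (\<lambda>x. f ((1 + \<epsilon>) * x)) Y * mat_adjoint E) (E * fun_calc f X * E)"
      by (rule eventually_mono[OF eventually_at_right_less step])
    show "hermitian_mat n (E * fun_calc f Y * mat_adjoint E)"
      by (rule hermitian_congruence[OF fun_calc_hermitian[OF hY] dE(1)])
    show "hermitian_mat n (E * fun_calc f X * E)"
      using hermitian_congruence[OF fun_calc_hermitian[OF hX] dE(1)] dE by simp
    fix v :: "complex vec" assume v: "v \<in> carrier_vec n"
    have w: "mat_adjoint E *\<^sub>v v \<in> carrier_vec n"
      by (rule mult_mat_vec_carrier[of _ n n]) (use v dE in auto)
    show "((\<lambda>\<epsilon>. qform (E * fun_calc (\<lambda>x. f ((1 + \<epsilon>) * x)) Y * mat_adjoint E) v) \<longlongrightarrow>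
      qform (E * fun_calc f Y * mat_adjoint E) v) (at_right 0)"
      unfolding qform_congruence[OF dE(1) dim_fun_calc(3)[OF hY] v]
      by (intro qform_fun_calc_tendsto[OF Y w] continuous_scaling_tendsto f)
  qed simp
  then show ?thesis using dE by (simp add: Y_def)
qed

text \<open>\<open>V V\<^sup>*\<close> is a projection, and \<open>V\<close> intertwines the compression to it with \<open>V\<^sup>* X V\<close>.\<close>

lemma operator_monotone_isometry:
  assumes f: "operator_monotone f" "continuous_on {0..} f"
    and V: "V \<in> carrier_mat n m" "mat_adjoint V * V = 1\<^sub>m m" and X: "psd_mat n X"
  shows "loewner_ge m (fun_calc f (mat_adjoint V * X * V)) (mat_adjoint V * fun_calc f X * V)"
proof -
  define E where "E = V * mat_adjoint V"
  have dV: "dim_row V = n" "dim_col V = m" using V by auto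
  have VV: "mat_adjoint V * (V * Z) = Z" if "dim_row Z = m" for Z
    using that dV V(2) by (simp flip: mat_mult_assoc)
  have E: "projection_mat n E"
    unfolding projection_mat_def E_def hermitian_mat_def
    using dV VV by (auto simp: mat_ring mat_adjoint_simps)
  note hE = projection_matD(1)[OF E] and hX = psd_imp_hermitian[OF X]
  note dE = hermitian_matD[OF hE] and dX = hermitian_matD[OF hX]
  have EV: "E * V = V" "mat_adjoint V * E = mat_adjoint V"
    unfolding E_def using dV VV V(2) by (simp_all add: mat_ring)
  have hEX: "hermitian_mat n (E * X * E)" using hermitian_congruence[OF hX dE(1)] dE by simp
  have hVX: "hermitian_mat m (mat_adjoint V * X * V)"
    using hermitian_congruence[OF hX, of "mat_adjoint V" m] V by simp
  have "E * X * E * V = V * (mat_adjoint V * X * V)"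
    unfolding E_def using dV dX V(2) by (simp add: mat_ring)
  then have fEX: "fun_calc f (E * X * E) * V = V * fun_calc f (mat_adjoint V * X * V)"
    by (rule fun_calc_intertwine[OF hEX hVX V(1)])
  have comp: "mat_adjoint V * (E * Z * E) * mat_adjoint (mat_adjoint V) = mat_adjoint V * (Z * V)"
    if "dim_row Z = n" "dim_col Z = n" for Z
  proof -
    have "mat_adjoint V * (E * Z * E) * V = (mat_adjoint V * E) * Z * (E * V)"
      using that dV dE by (simp add: mat_ring)
    also have "\<dots> = mat_adjoint V * (Z * V)"
      unfolding EV using that dV by (simp add: mat_ring)
    finally show ?thesis by simp
  qed
  have "loewner_ge m (mat_adjoint V * (E * fun_calc f (E * X * E) * E) * mat_adjoint (mat_adjoint V))
      (mat_adjoint V * (E * fun_calc f X * E) * mat_adjoint (mat_adjoint V))"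
    by (rule loewner_congruence[OF operator_monotone_compression[OF f E X]]) (use V in auto)
  then have "loewner_ge m (mat_adjoint V * (fun_calc f (E * X * E) * V)) (mat_adjoint V * (fun_calc f X * V))"
    unfolding comp[OF dim_fun_calc(1,2)[OF hEX]] comp[OF dim_fun_calc(1,2)[OF hX]] .
  then show ?thesis
    unfolding fEX using dim_fun_calc[OF hX] dim_fun_calc[OF hVX] dV
    by (simp add: VV mat_mult_assoc)
qed

lemma orthogonal_isometries_exist:
  obtains J K :: "complex mat" where "J \<in> carrier_mat (2 * n) n" "K \<in> carrier_mat (2 * n) n"
    "mat_adjoint J * J = 1\<^sub>m n" "mat_adjoint K * K = 1\<^sub>m n"
    "mat_adjoint J * K = 0\<^sub>m n n" "mat_adjoint K * J = 0\<^sub>m n n"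
proof
  define J K :: "complex mat"
    where "J = mat (2 * n) n (\<lambda>(i, j). if i = j then 1 else 0)"
      and "K = mat (2 * n) n (\<lambda>(i, j). if i = j + n then 1 else 0)"
  show "J \<in> carrier_mat (2 * n) n" "K \<in> carrier_mat (2 * n) n" by (auto simp: J_def K_def)
  have s: "(\<Sum>k<2 * n. cnj (if k = a then 1 else 0) * (if k = b then 1 else 0))
      = (if a = b then 1 else (0::complex))" if "a < 2 * n" for a b
  proof -
    have "(\<Sum>k<2 * n. cnj (if k = a then 1 else 0) * (if k = b then 1 else 0))
        = (\<Sum>k<2 * n. if k = a then if a = b then 1 else (0::complex) else 0)"
      by (rule sum.cong) auto
    then show ?thesis using that by simp
  qed
  show "mat_adjoint J * J = 1\<^sub>m n" "mat_adjoint K * K = 1\<^sub>m n"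
    "mat_adjoint J * K = 0\<^sub>m n n" "mat_adjoint K * J = 0\<^sub>m n n"
    by (rule eq_matI; simp add: J_def K_def scalar_prod_def atLeast0LessThan s)+
qed

text \<open>Split \<open>Y = P\<^sup>2 + Q\<^sup>2\<close> with \<open>P\<^sup>2 = X\<close> and \<open>Q\<^sup>2 = Y - X\<close>, and stack the two roots to \<open>T = J P + K Q\<close>, where
\<open>J\<close> and \<open>K\<close> embed the space as the two halves of its double. Then \<open>T\<^sup>* T = Y\<close>, while the compression
\<open>J\<^sup>* T T\<^sup>* J\<close> is \<open>X\<close>. With \<open>g(x) = f(x) / x\<close>, the compression inequality for \<open>T T\<^sup>*\<close> reads
\<open>P g(X) P \<ge> P g(Y) P\<close>, and \<open>P\<close> is invertible. Doubling the dimension is harmless because \<open>f\<close> is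
monotone on matrices of every size.\<close>

theorem operator_monotone_quotient_antimono:
  assumes f: "operator_monotone f" "continuous_on {0..} f" "f 0 = 0"
    and X: "pd_mat n X" and XY: "loewner_ge n Y X"
  shows "loewner_ge n (fun_calc (\<lambda>x. f x / x) X) (fun_calc (\<lambda>x. f x / x) Y)"
proof -
  let ?g = "\<lambda>x. f x / x"
  have Y: "pd_mat n Y" using pd_loewner[OF X XY] .
  note hX = psd_imp_hermitian[OF pd_imp_psd[OF X]] and hY = psd_imp_hermitian[OF pd_imp_psd[OF Y]]
  define P where "P = mat_powr X (1/2)"
  define Q where "Q = mat_powr (Y - X) (1/2)"
  have D: "psd_mat n (Y - X)" using XY by (simp add: loewner_ge_def)
  have PP: "P * P = X" and QQ: "Q * Q = Y - X"
    using mat_powr_add[OF hX, of "1/2" "1/2"] mat_powr_add[OF psd_imp_hermitian[OF D], of "1/2" "1/2"]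
    by (simp_all add: P_def Q_def mat_powr_1[OF pd_imp_psd[OF X]] mat_powr_1[OF D])
  have hP: "hermitian_mat n P" and hQ: "hermitian_mat n Q"
    unfolding P_def Q_def mat_powr_def by (intro fun_calc_hermitian hX psd_imp_hermitian[OF D])+
  note dP = hermitian_matD[OF hP] and dQ = hermitian_matD[OF hQ]
    and dX = hermitian_matD[OF hX] and dY = hermitian_matD[OF hY]
  obtain J K :: "complex mat" where J: "J \<in> carrier_mat (2 * n) n" and K: "K \<in> carrier_mat (2 * n) n"
    and JK: "mat_adjoint J * J = 1\<^sub>m n" "mat_adjoint K * K = 1\<^sub>m n"
    "mat_adjoint J * K = 0\<^sub>m n n" "mat_adjoint K * J = 0\<^sub>m n n"
    using orthogonal_isometries_exist by blast
  have dJ: "dim_row J = 2 * n" "dim_col J = n" and dK: "dim_row K = 2 * n" "dim_col K = n"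
    using J K by auto
  have JK': "mat_adjoint J * (J * Z) = Z" "mat_adjoint K * (K * Z) = Z"
    "mat_adjoint J * (K * Z) = 0\<^sub>m n (dim_col Z)" "mat_adjoint K * (J * Z) = 0\<^sub>m n (dim_col Z)"
    if "dim_row Z = n" for Z
    using that dJ dK JK by (simp_all flip: mat_mult_assoc)
  define T where "T = J * P + K * Q"
  have T: "T \<in> carrier_mat (2 * n) n" using dJ dK dP dQ by (auto simp: T_def intro!: carrier_matI)
  have dT: "dim_row T = 2 * n" "dim_col T = n" using T by auto
  have JT: "mat_adjoint J * T = P"
    unfolding T_def using dJ dK dP dQ by (simp add: mat_ring JK')
  have TT: "mat_adjoint T * T = Y"
  proof -
    have "mat_adjoint T * T = P * P + Q * Q"
      unfolding T_def using dJ dK dP dQ by (simp add: mat_ring mat_adjoint_simps JK')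
    also have "\<dots> = Y" unfolding PP QQ by (rule eq_matI) (use dX dY in auto)
    finally show ?thesis .
  qed
  have TJ: "mat_adjoint T * J = P"
    using arg_cong[OF JT, of mat_adjoint] dT dJ dP by (simp add: mat_adjoint_simps)
  let ?Z = "T * mat_adjoint T"
  have fg: "f x = ?g x * x" if "0 \<le> x" for x using f(3) by simp
  have "fun_calc f ?Z = T * fun_calc ?g Y * mat_adjoint T"
    using fun_calc_gram[OF T fg] by (simp add: TT)
  then have 1: "mat_adjoint J * fun_calc f ?Z * J = P * fun_calc ?g Y * P"
    using dJ dT dim_fun_calc[OF hY] JT TJ by (simp add: mat_mult_assoc flip: JT)
  have "mat_adjoint J * ?Z * J = P * P"
    using dJ dT by (simp add: mat_mult_assoc TJ) (simp add: JT dT dP flip: mat_mult_assoc)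
  then have 2: "fun_calc f (mat_adjoint J * ?Z * J) = P * fun_calc ?g X * P"
    using fun_calc_gram[OF dP(1) fg] by (simp add: dP PP)
  have "loewner_ge n (P * fun_calc ?g X * P) (P * fun_calc ?g Y * P)"
    using operator_monotone_isometry[OF f(1,2) J JK(1) psd_gram[OF T]] by (simp only: 1 2)
  then have le: "loewner_ge n (R * (P * fun_calc ?g X * P) * mat_adjoint R) (R * (P * fun_calc ?g Y * P) * mat_adjoint R)"
    if "R \<in> carrier_mat n n" for R
    by (rule loewner_congruence) (rule that)
  define R where "R = mat_powr X (-1/2)"
  have hR: "hermitian_mat n R" unfolding R_def mat_powr_def by (intro fun_calc_hermitian hX)
  note dR = hermitian_matD[OF hR]
  have RP: "R * P = 1\<^sub>m n" "P * R = 1\<^sub>m n"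
    using mat_powr_add[OF hX, of "-1/2" "1/2"] mat_powr_add[OF hX, of "1/2" "-1/2"]
    by (simp_all add: R_def P_def mat_powr_0[OF X])
  have "R * (P * Z * P) * mat_adjoint R = Z" if "dim_row Z = n" "dim_col Z = n" for Z
  proof -
    have "R * (P * Z * P) * mat_adjoint R = (R * P) * Z * (P * R)"
      using that dR dP by (simp add: mat_mult_assoc)
    then show ?thesis unfolding RP using that by simp
  qed
  then show ?thesis
    using le[OF dR(1)] dim_fun_calc[OF hX] dim_fun_calc[OF hY] by simp
qed

section \<open>Monotone limits of matrices\<close>

lemma mono_bounded_below_tendsto_at_right:
  fixes h :: "real \<Rightarrow> real"
  assumes mono: "\<And>s t. 0 < s \<Longrightarrow> s \<le> t \<Longrightarrow> h s \<le> h t" and ge: "\<And>t. 0 < t \<Longrightarrow> 0 \<le> h t"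
  obtains l where "(h \<longlongrightarrow> l) (at_right 0)"
proof
  have bdd: "bdd_below (h ` {0<..})" by (rule bdd_belowI2[of _ 0]) (use ge in auto)
  have ne: "h ` {0<..} \<noteq> {}" by simp
  show "(h \<longlongrightarrow> Inf (h ` {0<..})) (at_right 0)"
  proof (rule order_tendstoI)
    fix a assume "a < Inf (h ` {0<..})"
    moreover have "Inf (h ` {0<..}) \<le> h t" if "0 < t" for t
      using that by (intro cInf_lower bdd) auto
    ultimately show "\<forall>\<^sub>F t in at_right 0. a < h t"
      by (intro eventually_mono[OF eventually_at_right_less[of "0::real"]]) (use less_le_trans in blast)
  next
    fix a assume "Inf (h ` {0<..}) < a"
    then obtain t0 where t0: "0 < t0" "h t0 < a"
      using cInf_lessD[OF ne] by auto
    have "h t < a" if "t \<in> {0<..<t0}" for t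
      using mono[of t t0] that t0 by auto
    then show "\<forall>\<^sub>F t in at_right 0. h t < a"
      by (rule eventually_mono[OF eventually_at_right_real[OF t0(1)]])
  qed
qed

lemma cscalar_prod_swap:
  fixes u w :: "complex vec"
  assumes "u \<in> carrier_vec n" "w \<in> carrier_vec n"
  shows "u \<bullet>c w = cnj (w \<bullet>c u)"
  using assms by (auto simp: scalar_prod_def mult.commute)

lemma qform_polarize:
  assumes G: "hermitian_mat n G" and u: "u \<in> carrier_vec n" and w: "w \<in> carrier_vec n"
  shows "qform G (u + c \<cdot>\<^sub>v w) = qform G u + (cmod c)\<^sup>2 * qform G w + 2 * Re (c * ((G *\<^sub>v w) \<bullet>c u))"
proof -
  note dG = hermitian_matD[OF G]
  have c: "G *\<^sub>v u \<in> carrier_vec n" "G *\<^sub>v w \<in> carrier_vec n"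
    by (rule mult_mat_vec_carrier[of _ n n]; use dG u w in auto)+
  have Gv: "G *\<^sub>v (u + c \<cdot>\<^sub>v w) = G *\<^sub>v u + c \<cdot>\<^sub>v (G *\<^sub>v w)"
    using u w by (simp add: mult_add_distrib_mat_vec[OF dG(1)] mult_mat_vec[OF dG(1)])
  have "u \<bullet>c (G *\<^sub>v w) = cnj ((G *\<^sub>v w) \<bullet>c u)"
    by (rule cscalar_prod_swap[OF u c(2)])
  then have sym: "(G *\<^sub>v u) \<bullet>c w = cnj ((G *\<^sub>v w) \<bullet>c u)"
    using cscalar_prod_adjoint[OF dG(1) u w] dG(2) by simp
  have "(G *\<^sub>v (u + c \<cdot>\<^sub>v w)) \<bullet>c (u + c \<cdot>\<^sub>v w)
      = (G *\<^sub>v u) \<bullet>c u + cnj c * ((G *\<^sub>v u) \<bullet>c w)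
        + (c * ((G *\<^sub>v w) \<bullet>c u) + c * cnj c * ((G *\<^sub>v w) \<bullet>c w))"
    unfolding Gv using c u w
    by (simp add: conjugate_add_vec[of _ n] conjugate_smult_vec add_scalar_prod_distrib[of _ n]
        scalar_prod_add_distrib[of _ n] distrib_left)
  then show ?thesis
    unfolding qform_def sym complex_norm_square[symmetric, of c, folded complex_norm_square]
    by (simp add: complex_mult_cnj cmod_power2 flip: complex_norm_square)
qed

text \<open>The entries are linear combinations of values of the quadratic form, so convergence of the
quadratic form, which follows from monotonicity, implies entrywise convergence.\<close>

lemma hermitian_entry_polarize:
  assumes G: "hermitian_mat n G" and ij: "i < n" "j < n"
  defines "q \<equiv> \<lambda>c. (qform G (unit_vec n i + c \<cdot>\<^sub>v unit_vec n j) - qform G (unit_vec n i)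
      - qform G (unit_vec n j)) / 2"
  shows "G $$ (i, j) = Complex (q 1) (- q \<i>)"
proof -
  note dG = hermitian_matD[OF G]
  have "conjugate (unit_vec n i) = (unit_vec n i :: complex vec)"
    by (rule eq_vecI) (auto simp: unit_vec_def)
  then have "(G *\<^sub>v unit_vec n j) \<bullet>c unit_vec n i = G $$ (i, j)"
    using dG ij by (simp add: scalar_prod_right_unit)
  then show ?thesis
    unfolding q_def
    using qform_polarize[OF G, of "unit_vec n i" "unit_vec n j" 1]
      qform_polarize[OF G, of "unit_vec n i" "unit_vec n j" \<i>]
    by (simp add: complex_eq_iff)
qed

lemma qform_entries:
  assumes "A \<in> carrier_mat n n" "v \<in> carrier_vec n"
  shows "qform A v = Re (\<Sum>i<n. (\<Sum>j<n. A $$ (i, j) * v $ j) * cnj (v $ i))"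
  unfolding qform_def
  using assms by (auto simp: scalar_prod_def atLeast0LessThan intro!: sum.cong)

lemma loewner_monotone_limit:
  fixes G :: "real \<Rightarrow> complex mat"
  assumes mono: "\<And>s t. 0 < s \<Longrightarrow> s \<le> t \<Longrightarrow> loewner_ge n (G t) (G s)"
    and psd: "\<And>t. 0 < t \<Longrightarrow> psd_mat n (G t)"
  obtains M where "psd_mat n M"
    "\<And>i j. i < n \<Longrightarrow> j < n \<Longrightarrow> ((\<lambda>t. G t $$ (i, j)) \<longlongrightarrow> M $$ (i, j)) (at_right 0)"
    "\<And>v. v \<in> carrier_vec n \<Longrightarrow> ((\<lambda>t. qform (G t) v) \<longlongrightarrow> qform M v) (at_right 0)"
proof -
  have pos: "\<forall>\<^sub>F t in at_right 0. 0 < (t::real)" by (rule eventually_at_right_less)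
  have q: "\<exists>l. ((\<lambda>t. qform (G t) v) \<longlongrightarrow> l) (at_right 0)" if "v \<in> carrier_vec n" for v
    by (rule mono_bounded_below_tendsto_at_right[of "\<lambda>t. qform (G t) v"])
      (use that mono psd in \<open>auto simp: loewner_ge_iff psd_mat_iff\<close>)
  have "\<exists>l. ((\<lambda>t. G t $$ (i, j)) \<longlongrightarrow> l) (at_right 0)" if ij: "i < n" "j < n" for i j
  proof -
    let ?c = "\<lambda>t. Complex
        ((qform (G t) (unit_vec n i + 1 \<cdot>\<^sub>v unit_vec n j) - qform (G t) (unit_vec n i)
          - qform (G t) (unit_vec n j)) / 2)
        (- ((qform (G t) (unit_vec n i + \<i> \<cdot>\<^sub>v unit_vec n j) - qform (G t) (unit_vec n i)
          - qform (G t) (unit_vec n j)) / 2))"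
    have c: "unit_vec n i + c \<cdot>\<^sub>v unit_vec n j \<in> carrier_vec n" for c :: complex by simp
    obtain l1 l2 l3 l4 where l: "((\<lambda>t. qform (G t) (unit_vec n i)) \<longlongrightarrow> l1) (at_right 0)"
      "((\<lambda>t. qform (G t) (unit_vec n j)) \<longlongrightarrow> l2) (at_right 0)"
      "((\<lambda>t. qform (G t) (unit_vec n i + 1 \<cdot>\<^sub>v unit_vec n j)) \<longlongrightarrow> l3) (at_right 0)"
      "((\<lambda>t. qform (G t) (unit_vec n i + \<i> \<cdot>\<^sub>v unit_vec n j)) \<longlongrightarrow> l4) (at_right 0)"
      using q[OF unit_vec_carrier] q[OF c] by metis
    have "(?c \<longlongrightarrow> Complex ((l3 - l1 - l2) / 2) (- ((l4 - l1 - l2) / 2))) (at_right 0)"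
      by (intro tendsto_intros l) auto
    moreover have "\<forall>\<^sub>F t in at_right 0. ?c t = G t $$ (i, j)"
    proof (rule eventually_mono[OF pos])
      fix t :: real assume "0 < t"
      show "?c t = G t $$ (i, j)"
        by (rule hermitian_entry_polarize[OF psd_imp_hermitian[OF psd[OF \<open>0 < t\<close>]] ij, symmetric])
    qed
    ultimately have "((\<lambda>t. G t $$ (i, j)) \<longlongrightarrow> Complex ((l3 - l1 - l2) / 2) (- ((l4 - l1 - l2) / 2)))
      (at_right 0)"
      by (rule Lim_transform_eventually)
    then show ?thesis by blast
  qed
  then obtain L where L: "\<And>i j. i < n \<Longrightarrow> j < n \<Longrightarrow> ((\<lambda>t. G t $$ (i, j)) \<longlongrightarrow> L i j) (at_right 0)"
    by metis
  define M where "M = mat n n (\<lambda>(i, j). L i j)"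
  have M: "M \<in> carrier_mat n n" by (simp add: M_def)
  have ent: "((\<lambda>t. G t $$ (i, j)) \<longlongrightarrow> M $$ (i, j)) (at_right 0)" if "i < n" "j < n" for i j
    using L that by (simp add: M_def)
  have qf: "((\<lambda>t. qform (G t) v) \<longlongrightarrow> qform M v) (at_right 0)" if v: "v \<in> carrier_vec n" for v
  proof -
    have "\<forall>\<^sub>F t in at_right 0. Re (\<Sum>i<n. (\<Sum>j<n. G t $$ (i, j) * v $ j) * cnj (v $ i)) = qform (G t) v"
      by (rule eventually_mono[OF pos])
        (use qform_entries[OF _ v] hermitian_matD(1)[OF psd_imp_hermitian[OF psd]] in simp)
    moreover have "((\<lambda>t. Re (\<Sum>i<n. (\<Sum>j<n. G t $$ (i, j) * v $ j) * cnj (v $ i)))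
        \<longlongrightarrow> qform M v) (at_right 0)"
      unfolding qform_entries[OF M v] by (intro tendsto_intros ent) auto
    ultimately show ?thesis by (rule Lim_transform_eventually[rotated])
  qed
  have "hermitian_mat n M"
    unfolding hermitian_mat_def
  proof (intro conjI M eq_matI)
    fix i j assume "i < dim_row M" "j < dim_col M"
    then have ij: "i < n" "j < n" using M by auto
    have "\<forall>\<^sub>F t in at_right 0. cnj (G t $$ (j, i)) = G t $$ (i, j)"
    proof (rule eventually_mono[OF pos])
      fix t :: real assume "0 < t"
      from hermitian_matD[OF psd_imp_hermitian[OF psd[OF this]]] ij
      show "cnj (G t $$ (j, i)) = G t $$ (i, j)" by (metis index_mat_adjoint)
    qed
    moreover have "((\<lambda>t. cnj (G t $$ (j, i))) \<longlongrightarrow> cnj (M $$ (j, i))) (at_right 0)"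
      by (intro tendsto_intros ent ij)
    ultimately have "((\<lambda>t. G t $$ (i, j)) \<longlongrightarrow> cnj (M $$ (j, i))) (at_right 0)"
      by (rule Lim_transform_eventually[rotated])
    then have "cnj (M $$ (j, i)) = M $$ (i, j)"
      using tendsto_unique[OF _ _ ent[OF ij]] by simp
    then show "mat_adjoint M $$ (i, j) = M $$ (i, j)" using M ij by simp
  qed (use M in auto)
  moreover have "0 \<le> qform M v" if v: "v \<in> carrier_vec n" for v
    by (rule tendsto_lowerbound[OF qf[OF v]])
      (use psd v in \<open>auto simp: psd_mat_iff intro: eventually_mono[OF pos]\<close>)
  ultimately have "psd_mat n M" by (simp add: psd_mat_iff)
  then show ?thesis using that ent qf by blast
qed

section \<open>Operator means\<close>

lemma pd_congruence:
  assumes A: "pd_mat n A" and S: "S \<in> carrier_mat n n" and R: "R \<in> carrier_mat n n" "R * mat_adjoint S = 1\<^sub>m n"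
  shows "pd_mat n (S * A * mat_adjoint S)"
proof -
  note dA = hermitian_matD[OF psd_imp_hermitian[OF pd_imp_psd[OF A]]]
  have "0 < qform (S * A * mat_adjoint S) v" if v: "v \<in> carrier_vec n" "v \<noteq> 0\<^sub>v n" for v
  proof -
    have w: "mat_adjoint S *\<^sub>v v \<in> carrier_vec n"
      by (rule mult_mat_vec_carrier[of _ n n]) (use v S in auto)
    have "R *\<^sub>v (mat_adjoint S *\<^sub>v v) = v"
      using R S v by (subst assoc_mult_mat_vec[of _ n n _ n, symmetric]) auto
    moreover have "R *\<^sub>v 0\<^sub>v n = 0\<^sub>v n"
      using R by (intro eq_vecI) (auto simp: scalar_prod_def)
    ultimately have "mat_adjoint S *\<^sub>v v \<noteq> 0\<^sub>v n" using v by auto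
    then show ?thesis using A w qform_congruence[OF S dA(1) v(1)] by (simp add: pd_mat_iff)
  qed
  then show ?thesis
    using hermitian_congruence[OF psd_imp_hermitian[OF pd_imp_psd[OF A]] S] by (simp add: pd_mat_iff)
qed

lemma mat_powr_half:
  assumes "pd_mat n A"
  shows "mat_powr A (1/2) * mat_powr A (1/2) = A"
    "mat_powr A (-1/2) * mat_powr A (-1/2) = mat_powr A (-1)"
    "mat_powr A (1/2) * mat_powr A (-1/2) = 1\<^sub>m n"
    "mat_powr A (-1/2) * mat_powr A (1/2) = 1\<^sub>m n"
    "hermitian_mat n (mat_powr A s)"
proof -
  note h = psd_imp_hermitian[OF pd_imp_psd[OF assms]]
  show "mat_powr A (1/2) * mat_powr A (1/2) = A"
    "mat_powr A (-1/2) * mat_powr A (-1/2) = mat_powr A (-1)"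
    "mat_powr A (1/2) * mat_powr A (-1/2) = 1\<^sub>m n"
    "mat_powr A (-1/2) * mat_powr A (1/2) = 1\<^sub>m n"
    by (simp_all add: mat_powr_add[OF h] mat_powr_1[OF pd_imp_psd[OF assms]] mat_powr_0[OF assms])
  show "hermitian_mat n (mat_powr A s)"
    unfolding mat_powr_def by (rule fun_calc_hermitian[OF h])
qed

locale mean_function =
  fixes f :: "real \<Rightarrow> real"
  assumes mono: "operator_monotone f" and cont: "continuous_on {0..} f"
    and f0: "f 0 = 0" and nonneg: "\<And>x. 0 \<le> x \<Longrightarrow> 0 \<le> f x"
begin

abbreviation quotient :: "real \<Rightarrow> real" where
  "quotient x \<equiv> f x / x"

text \<open>Any factorization \<open>B = S S\<^sup>*\<close> gives \<open>A \<sigma> B = S g(S\<^sup>* A\<^sup>-\<^sup>1 S) S\<^sup>*\<close> with \<open>g(x) = f(x) / x\<close>: with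
\<open>T = A\<^sup>-\<^sup>1\<^sup>/\<^sup>2 S\<close> the mean is \<open>A\<^sup>1\<^sup>/\<^sup>2 f(T T\<^sup>*) A\<^sup>1\<^sup>/\<^sup>2\<close>. In this form \<open>A\<close> occurs only once, and \<open>S\<close> may be
a projection.\<close>

lemma op_mean_pd_factored:
  assumes A: "pd_mat n A" and S: "S \<in> carrier_mat n m"
  shows "op_mean_pd f A (S * mat_adjoint S)
    = S * fun_calc quotient (mat_adjoint S * mat_powr A (-1) * S) * mat_adjoint S"
proof -
  note half = mat_powr_half[OF A]
  define P R where "P = mat_powr A (1/2)" and "R = mat_powr A (-1/2)"
  have PR: "P * R = 1\<^sub>m n" "R * P = 1\<^sub>m n" "R * R = mat_powr A (-1)"
    by (simp_all only: P_def R_def half)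
  have hP: "hermitian_mat n P" and hR: "hermitian_mat n R" by (simp_all only: P_def R_def half)
  note dP = hermitian_matD[OF hP] and dR = hermitian_matD[OF hR]
  have dS: "dim_row S = n" "dim_col S = m" using S by auto
  define T where "T = R * S"
  have T: "T \<in> carrier_mat n m" using dR dS by (auto simp: T_def intro!: carrier_matI)
  have Tadj: "mat_adjoint T = mat_adjoint S * R" using dR dS by (simp add: T_def mat_adjoint_simps)
  have TT: "mat_adjoint T * T = mat_adjoint S * mat_powr A (-1) * S"
    using dR dS unfolding Tadj PR(3)[symmetric] by (simp add: T_def mat_mult_assoc)
  have hTT: "hermitian_mat m (mat_adjoint T * T)"
    using psd_imp_hermitian[OF psd_gram[of "mat_adjoint T" m n]] T by simp
  have PT: "P * T = S" "mat_adjoint T * P = mat_adjoint S"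
  proof -
    have "P * T = (P * R) * S" using dR dS dP by (simp add: T_def mat_mult_assoc)
    then show "P * T = S" unfolding PR using dS by simp
    have "mat_adjoint T * P = mat_adjoint S * (R * P)" using dR dS dP by (simp add: Tadj mat_mult_assoc)
    then show "mat_adjoint T * P = mat_adjoint S" unfolding PR using dS by simp
  qed
  have "R * (S * mat_adjoint S) * R = T * mat_adjoint T"
    using dR dS unfolding Tadj by (simp add: T_def mat_mult_assoc)
  then have "op_mean_pd f A (S * mat_adjoint S) = P * fun_calc f (T * mat_adjoint T) * P"
    by (simp add: op_mean_pd_def P_def R_def)
  also have "fun_calc f (T * mat_adjoint T) = T * fun_calc quotient (mat_adjoint T * T) * mat_adjoint T"
    by (rule fun_calc_gram[OF T]) (simp add: f0)
  also have "P * (T * fun_calc quotient (mat_adjoint T * T) * mat_adjoint T) * P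
      = (P * T) * fun_calc quotient (mat_adjoint T * T) * (mat_adjoint T * P)"
    using dP T dim_fun_calc[OF hTT] by (simp add: mat_mult_assoc)
  finally show ?thesis unfolding PT TT .
qed

lemma op_mean_pd_psd:
  assumes A: "pd_mat n A" and B: "psd_mat n B"
  shows "psd_mat n (op_mean_pd f A B)"
proof -
  have P: "mat_powr A s \<in> carrier_mat n n" "mat_adjoint (mat_powr A s) = mat_powr A s" for s
    using hermitian_matD[OF mat_powr_half(5)[OF A]] by auto
  have "psd_mat n (mat_powr A (-1/2) * B * mat_adjoint (mat_powr A (-1/2)))"
    by (rule psd_mat_congruence[OF B P(1)])
  from psd_mat_congruence[OF fun_calc_psd[OF this nonneg] P(1)[of "1/2"]]
  show ?thesis by (simp add: op_mean_pd_def P(2))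
qed

lemma op_mean_pd_mono_right:
  assumes A: "pd_mat n A" and B: "psd_mat n B" and BB: "loewner_ge n B' B"
  shows "loewner_ge n (op_mean_pd f A B') (op_mean_pd f A B)"
proof -
  have P: "mat_powr A s \<in> carrier_mat n n" "mat_adjoint (mat_powr A s) = mat_powr A s" for s
    using hermitian_matD[OF mat_powr_half(5)[OF A]] by auto
  have B': "psd_mat n B'" using psd_loewner[OF B BB] .
  show ?thesis
    using loewner_congruence[OF operator_monotoneD[OF mono
      psd_mat_congruence[OF B' P(1)[of "-1/2"]] psd_mat_congruence[OF B P(1)]
      loewner_congruence[OF BB P(1)]] P(1)[of "1/2"]]
    by (simp add: op_mean_pd_def P(2))
qed

text \<open>In the factored form the first argument passes through two antitone maps, the inverse and \<open>g\<close>.\<close>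

lemma op_mean_pd_mono_left:
  assumes A: "pd_mat n A" and AA: "loewner_ge n A' A" and B: "pd_mat n B"
  shows "loewner_ge n (op_mean_pd f A' B) (op_mean_pd f A B)"
proof -
  have A': "pd_mat n A'" using pd_loewner[OF A AA] .
  define S where "S = mat_powr B (1/2)"
  define R where "R = mat_powr B (-1/2)"
  have hS: "hermitian_mat n S" and hR: "hermitian_mat n R"
    by (simp_all only: S_def R_def mat_powr_half[OF B])
  note dS = hermitian_matD[OF hS] and dR = hermitian_matD[OF hR]
  have SS: "S * S = B" by (simp only: S_def mat_powr_half[OF B])
  have eq: "op_mean_pd f X B = S * fun_calc quotient (S * mat_powr X (-1) * S) * S"
    if "pd_mat n X" for X
    using op_mean_pd_factored[OF that dS(1)] unfolding dS(2) SS .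
  have "R * mat_adjoint S = 1\<^sub>m n" unfolding dS(2) by (simp only: S_def R_def mat_powr_half[OF B])
  then have "pd_mat n (S * mat_powr A' (-1) * mat_adjoint S)"
    by (rule pd_congruence[OF mat_powr_pd[OF A'] dS(1) dR(1)])
  moreover have "loewner_ge n (S * mat_powr A (-1) * mat_adjoint S) (S * mat_powr A' (-1) * mat_adjoint S)"
    by (rule loewner_congruence[OF loewner_inverse_antimono[OF A AA] dS(1)])
  ultimately have "loewner_ge n (fun_calc quotient (S * mat_powr A' (-1) * mat_adjoint S))
      (fun_calc quotient (S * mat_powr A (-1) * mat_adjoint S))"
    by (rule operator_monotone_quotient_antimono[OF mono cont f0])
  from loewner_congruence[OF this dS(1)] show ?thesis
    unfolding eq[OF A] eq[OF A'] dS(2) .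
qed

text \<open>With \<open>R = A\<^sup>-\<^sup>1\<^sup>/\<^sup>2\<close>, the argument \<open>R (B + \<delta>) R\<close> of \<open>f\<close> is at most \<open>R B R + c \<delta>\<close>. The latter commutes with
\<open>R B R\<close>, so by monotonicity of \<open>f\<close> the scalar continuity of \<open>f\<close> suffices.\<close>

lemma op_mean_pd_right_continuous:
  assumes A: "pd_mat n A" and B: "psd_mat n B" and M: "hermitian_mat n M"
    and le: "\<forall>\<^sub>F \<delta> in at_right 0. loewner_ge n (op_mean_pd f A (B + complex_of_real \<delta> \<cdot>\<^sub>m 1\<^sub>m n)) M"
  shows "loewner_ge n (op_mean_pd f A B) M"
proof -
  note half = mat_powr_half[OF A]
  define P R where "P = mat_powr A (1/2)" and "R = mat_powr A (-1/2)"
  have hP: "hermitian_mat n P" and hR: "hermitian_mat n R" by (simp_all only: P_def R_def half)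
  note dP = hermitian_matD[OF hP] and dR = hermitian_matD[OF hR]
    and dB = hermitian_matD[OF psd_imp_hermitian[OF B]]
  have om: "op_mean_pd f A X = P * fun_calc f (R * X * mat_adjoint R) * mat_adjoint P" for X
    by (simp only: op_mean_pd_def dP(2) dR(2)) (simp only: P_def R_def)
  define C where "C = R * B * mat_adjoint R"
  have C: "psd_mat n C" unfolding C_def by (rule psd_mat_congruence[OF B dR(1)])
  note hC = psd_imp_hermitian[OF C]
  obtain c where c: "0 < c" "loewner_ge n (complex_of_real c \<cdot>\<^sub>m 1\<^sub>m n) (R * mat_adjoint R)"
    using psd_mat_bounded[OF psd_gram[OF dR(1)]] by blast
  let ?\<phi> = "\<lambda>\<delta> x. f (x + c * \<delta>)"
  have upper: "loewner_ge n (P * fun_calc (?\<phi> \<delta>) C * mat_adjoint P)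
      (op_mean_pd f A (B + complex_of_real \<delta> \<cdot>\<^sub>m 1\<^sub>m n))" if \<delta>: "0 < \<delta>" for \<delta>
  proof -
    have B\<delta>: "psd_mat n (B + complex_of_real \<delta> \<cdot>\<^sub>m 1\<^sub>m n)" by (rule pd_imp_psd[OF pd_shift[OF B \<delta>]])
    have eq: "R * (B + complex_of_real \<delta> \<cdot>\<^sub>m 1\<^sub>m n) * mat_adjoint R
        = C + complex_of_real \<delta> \<cdot>\<^sub>m (R * mat_adjoint R)"
      unfolding C_def using dR dB by (simp add: mat_ring)
    have "loewner_ge n (complex_of_real \<delta> \<cdot>\<^sub>m (complex_of_real c \<cdot>\<^sub>m 1\<^sub>m n))
        (complex_of_real \<delta> \<cdot>\<^sub>m (R * mat_adjoint R))"
      by (rule loewner_smult[OF c(2)]) (use \<delta> in simp)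
    moreover have "complex_of_real \<delta> \<cdot>\<^sub>m (complex_of_real c \<cdot>\<^sub>m 1\<^sub>m n) = complex_of_real (c * \<delta>) \<cdot>\<^sub>m 1\<^sub>m n"
      by (rule eq_matI) auto
    ultimately have "loewner_ge n (C + complex_of_real (c * \<delta>) \<cdot>\<^sub>m 1\<^sub>m n)
        (R * (B + complex_of_real \<delta> \<cdot>\<^sub>m 1\<^sub>m n) * mat_adjoint R)"
      unfolding eq by (intro loewner_add loewner_refl hC) simp
    moreover have "psd_mat n (C + complex_of_real (c * \<delta>) \<cdot>\<^sub>m 1\<^sub>m n)"
      by (rule pd_imp_psd[OF pd_shift[OF C]]) (use c \<delta> in simp)
    moreover have "psd_mat n (R * (B + complex_of_real \<delta> \<cdot>\<^sub>m 1\<^sub>m n) * mat_adjoint R)"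
      by (rule psd_mat_congruence[OF B\<delta> dR(1)])
    ultimately have "loewner_ge n (fun_calc f (C + complex_of_real (c * \<delta>) \<cdot>\<^sub>m 1\<^sub>m n))
      (fun_calc f (R * (B + complex_of_real \<delta> \<cdot>\<^sub>m 1\<^sub>m n) * mat_adjoint R))"
      using operator_monotoneD[OF mono] by blast
    moreover have "fun_calc f (C + complex_of_real (c * \<delta>) \<cdot>\<^sub>m 1\<^sub>m n) = fun_calc (?\<phi> \<delta>) C"
      by (simp only: fun_calc_shift[OF hC] fun_calc_comp[OF hC])
    ultimately have "loewner_ge n (P * fun_calc (?\<phi> \<delta>) C * mat_adjoint P)
      (P * fun_calc f (R * (B + complex_of_real \<delta> \<cdot>\<^sub>m 1\<^sub>m n) * mat_adjoint R) * mat_adjoint P)"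
      using loewner_congruence[OF _ dP(1)] by simp
    then show ?thesis unfolding om .
  qed
  have "loewner_ge n (P * fun_calc f C * mat_adjoint P) M"
  proof (rule loewner_ge_limit[where F = "at_right 0"])
    show "\<forall>\<^sub>F \<delta> in at_right 0. loewner_ge n (P * fun_calc (?\<phi> \<delta>) C * mat_adjoint P) M"
      using eventually_conj[OF le eventually_at_right_less[of 0]]
      by (rule eventually_mono) (use upper loewner_trans in blast)
    show "hermitian_mat n (P * fun_calc f C * mat_adjoint P)"
      by (rule hermitian_congruence[OF fun_calc_hermitian[OF hC] dP(1)])
    fix v :: "complex vec" assume v: "v \<in> carrier_vec n"
    have w: "mat_adjoint P *\<^sub>v v \<in> carrier_vec n"
      by (rule mult_mat_vec_carrier[of _ n n]) (use v dP in auto)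
    have "((\<lambda>\<delta>. ?\<phi> \<delta> x) \<longlongrightarrow> f x) (at_right 0)" if "0 \<le> x" for x
    proof (rule continuous_on_tendsto_compose[OF cont])
      show "((\<lambda>\<delta>. x + c * \<delta>) \<longlongrightarrow> x) (at_right 0)" by (auto intro!: tendsto_eq_intros)
      show "\<forall>\<^sub>F \<delta> in at_right 0. x + c * \<delta> \<in> {0..}"
        by (rule eventually_mono[OF eventually_at_right_less[of 0]]) (use that c in auto)
    qed (use that in auto)
    then show "((\<lambda>\<delta>. qform (P * fun_calc (?\<phi> \<delta>) C * mat_adjoint P) v) \<longlongrightarrow>
      qform (P * fun_calc f C * mat_adjoint P) v) (at_right 0)"
      unfolding qform_congruence[OF dP(1) dim_fun_calc(3)[OF hC] v]
      by (rule qform_fun_calc_tendsto[OF C w])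
  qed (use M in auto)
  then show ?thesis unfolding om C_def .
qed

text \<open>By joint monotonicity the regularized means decrease as \<open>\<epsilon>\<close> tends to zero, so the limit that defines
the mean exists. The other two parts compare it with means whose second argument is \<open>B\<close> itself and
not \<open>B + \<epsilon>\<close>; together they say that the limit is the greatest lower bound of the means
\<open>(A + \<epsilon>) \<sigma> B\<close>, in which only the first argument is regularized.\<close>

lemma op_mean_singular:
  assumes A: "psd_mat n A" and B: "psd_mat n B" and sing: "\<not> pd_mat n A"
  shows op_mean_singular_psd: "psd_mat n (op_mean f A B)"
    and op_mean_singular_le: "\<And>A' \<epsilon>. 0 < \<epsilon> \<Longrightarrow> loewner_ge n A' (A + complex_of_real \<epsilon> \<cdot>\<^sub>m 1\<^sub>m n) \<Longrightarrow>
        loewner_ge n (op_mean_pd f A' B) (op_mean f A B)"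
    and op_mean_singular_greatest: "\<And>Z. hermitian_mat n Z \<Longrightarrow>
        (\<And>\<epsilon>. 0 < \<epsilon> \<Longrightarrow> loewner_ge n (op_mean_pd f (A + complex_of_real \<epsilon> \<cdot>\<^sub>m 1\<^sub>m n) B) Z) \<Longrightarrow>
        loewner_ge n (op_mean f A B) Z"
proof -
  let ?s = "\<lambda>X \<epsilon>. X + complex_of_real \<epsilon> \<cdot>\<^sub>m 1\<^sub>m n"
  let ?G = "\<lambda>\<epsilon>. op_mean_pd f (?s A \<epsilon>) (?s B \<epsilon>)"
  have dA: "dim_row A = n" using hermitian_matD[OF psd_imp_hermitian[OF A]] by simp
  have pd: "pd_mat n (?s X \<epsilon>)" if "psd_mat n X" "0 < \<epsilon>" for X \<epsilon> using pd_shift that by blast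
  have shift_mono: "loewner_ge n (?s X t) (?s X s)" if "psd_mat n X" "s \<le> t" for X s t
  proof -
    have "loewner_ge n (complex_of_real t \<cdot>\<^sub>m 1\<^sub>m n) (complex_of_real s \<cdot>\<^sub>m 1\<^sub>m n)"
      using that(2) by (auto simp: loewner_ge_iff hermitian_smult qform_smult[of _ n] qform_one
          intro!: mult_right_mono Re_cscalar_prod_ge_0)
    then show ?thesis by (intro loewner_add loewner_refl psd_imp_hermitian[OF that(1)])
  qed
  have shift_ge: "loewner_ge n (?s X t) X" if "psd_mat n X" "0 < t" for X t
    using shift_mono[of X 0 t] that hermitian_matD[OF psd_imp_hermitian[OF that(1)]] by simp
  have mono_both: "loewner_ge n (?G t) (?G s)" if "0 < s" "s \<le> t" for s t
  proof -
    have t: "0 < t" using that by simp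
    show ?thesis
      by (rule loewner_trans[OF op_mean_pd_mono_left[OF pd[OF A that(1)] shift_mono[OF A that(2)] pd[OF B t]]
        op_mean_pd_mono_right[OF pd[OF A that(1)] pd_imp_psd[OF pd[OF B that(1)]] shift_mono[OF B that(2)]]])
  qed
  obtain M where M: "psd_mat n M"
    "\<And>i j. i < n \<Longrightarrow> j < n \<Longrightarrow> ((\<lambda>t. ?G t $$ (i, j)) \<longlongrightarrow> M $$ (i, j)) (at_right 0)"
    "\<And>v. v \<in> carrier_vec n \<Longrightarrow> ((\<lambda>t. qform (?G t) v) \<longlongrightarrow> qform M v) (at_right 0)"
  proof (rule loewner_monotone_limit[of n ?G])
    show "psd_mat n (?G t)" if "0 < t" for t
      by (rule op_mean_pd_psd[OF pd[OF A that] pd_imp_psd[OF pd[OF B that]]])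
  qed (use mono_both in blast)+
  note hM = psd_imp_hermitian[OF M(1)]
  have "op_mean f A B = M"
  proof (rule eq_matI)
    fix i j assume "i < dim_row M" "j < dim_col M"
    then have "i < n" "j < n" using hermitian_matD[OF hM] by auto
    then show "op_mean f A B $$ (i, j) = M $$ (i, j)"
      using sing tendsto_Lim[OF _ M(2)] by (simp add: op_mean_def dA)
  qed (use hermitian_matD[OF hM] sing in \<open>auto simp: op_mean_def dA\<close>)
  note op_M = this
  show "psd_mat n (op_mean f A B)" using M op_M by simp
  show "loewner_ge n (op_mean f A B) Z"
    if Z: "hermitian_mat n Z" "\<And>\<epsilon>. 0 < \<epsilon> \<Longrightarrow> loewner_ge n (op_mean_pd f (?s A \<epsilon>) B) Z" for Z
    unfolding op_M
  proof (rule loewner_ge_limit[where F = "at_right 0"])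
    have "loewner_ge n (?G \<epsilon>) Z" if \<epsilon>: "0 < \<epsilon>" for \<epsilon>
      by (rule loewner_trans[OF op_mean_pd_mono_right[OF pd[OF A \<epsilon>] B shift_ge[OF B \<epsilon>]] Z(2)[OF \<epsilon>]])
    then show "\<forall>\<^sub>F \<epsilon> in at_right 0. loewner_ge n (?G \<epsilon>) Z"
      by (rule eventually_mono[OF eventually_at_right_less[of 0]])
  qed (use hM Z M(3) in auto)
  have G_ge: "loewner_ge n (?G t) M" if t: "0 < t" for t
  proof -
    have "qform M v \<le> qform (?G t) v" if v: "v \<in> carrier_vec n" for v
    proof (rule tendsto_upperbound[OF M(3)[OF v]])
      show "\<forall>\<^sub>F s in at_right 0. qform (?G s) v \<le> qform (?G t) v"
        using eventually_at_right_real[OF t]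
        by (rule eventually_mono) (use mono_both v in \<open>auto simp: loewner_ge_iff\<close>)
    qed simp
    then show ?thesis
      using hM psd_imp_hermitian[OF op_mean_pd_psd[OF pd[OF A t] pd_imp_psd[OF pd[OF B t]]]]
      by (simp add: loewner_ge_iff)
  qed
  show "loewner_ge n (op_mean_pd f A' B) (op_mean f A B)"
    if \<epsilon>: "0 < \<epsilon>" and A': "loewner_ge n A' (?s A \<epsilon>)" for A' \<epsilon>
    unfolding op_M
  proof (rule op_mean_pd_right_continuous[OF pd_loewner[OF pd[OF A \<epsilon>] A'] B hM])
    have "loewner_ge n (op_mean_pd f A' (?s B t)) M" if t: "t \<in> {0<..<\<epsilon>}" for t
    proof -
      have t': "0 < t" "t \<le> \<epsilon>" using t by auto
      have "loewner_ge n (op_mean_pd f A' (?s B t)) (?G t)"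
        by (rule op_mean_pd_mono_left[OF pd[OF A t'(1)] loewner_trans[OF A' shift_mono[OF A t'(2)]] pd[OF B t'(1)]])
      then show ?thesis using G_ge[OF t'(1)] loewner_trans by blast
    qed
    then show "\<forall>\<^sub>F t in at_right 0. loewner_ge n (op_mean_pd f A' (?s B t)) M"
      by (rule eventually_mono[OF eventually_at_right_real[OF \<epsilon>]])
  qed
qed

end

section \<open>Means with a projection\<close>

text \<open>Off the range of \<open>E\<close> the compression \<open>E G E\<close> is zero, and \<open>h 0 = 0\<close> keeps it so.\<close>

lemma fun_calc_reducing_projection:
  assumes E: "projection_mat n E" and G: "hermitian_mat n G" and comm: "G * E = E * G"
  shows "E * fun_calc h G = fun_calc h G * E"
    and "h 0 = 0 \<Longrightarrow> fun_calc h (E * G * E) = E * fun_calc h G * E"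
proof -
  define F where "F = 1\<^sub>m n - E"
  note hE = projection_matD(1)[OF E] and FF = projection_complement[OF E, folded F_def]
  note dE = hermitian_matD[OF hE] and dF = hermitian_matD[OF FF(1)] and dG = hermitian_matD[OF G]
  note dh = dim_fun_calc[OF G]
  show hG: "E * fun_calc h G = fun_calc h G * E"
    by (rule fun_calc_intertwine[OF G G dE(1) comm, symmetric])
  define N where "N = E * G * E"
  have hN: "hermitian_mat n N"
    using hermitian_congruence[OF G dE(1)] dE by (simp add: N_def)
  note dN = hermitian_matD[OF hN] and dhN = dim_fun_calc[OF hN]
  show "fun_calc h (E * G * E) = E * fun_calc h G * E" if "h 0 = 0"
  proof -
    have "N * E = E * (G * E)"
      unfolding N_def using dE dG projection_matD(2)[OF E] by (simp add: mat_mult_assoc)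
    also have "\<dots> = E * G"
      unfolding comm by (rule projection_matD(3)[OF E dG(3)])
    finally have "fun_calc h N * E = E * fun_calc h G"
      by (rule fun_calc_intertwine[OF hN G dE(1)])
    moreover have "fun_calc h N * F = F * fun_calc h (0\<^sub>m n n)"
    proof (rule fun_calc_intertwine[OF hN hermitian_zero dF(1)])
      have "N * F = E * G * (E * F)" unfolding N_def using dE dG dF by (simp add: mat_mult_assoc)
      then show "N * F = F * 0\<^sub>m n n" unfolding FF(3) using dE dG dF by simp
    qed
    moreover have "F * fun_calc h (0\<^sub>m n n) = 0\<^sub>m n n"
      using dF by (simp add: fun_calc_zero_mat[of h, OF that])
    moreover have "fun_calc h N = fun_calc h N * (E + F)" unfolding FF(5) using dhN by simp
    moreover have "fun_calc h N * (E + F) = fun_calc h N * E + fun_calc h N * F"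
      using dhN dE dF by (simp add: mat_ring)
    moreover have "E * fun_calc h G * E = E * fun_calc h G"
      unfolding hG using dh dE projection_matD(2)[OF E] by (simp add: mat_mult_assoc)
    ultimately show ?thesis using dE dh by (simp add: N_def[symmetric])
  qed
qed

text \<open>The added complementary projection makes this positive definite whenever \<open>X\<close> is, so results on
positive definite matrices apply to the compression without passing to a smaller space.\<close>

definition completed_compression :: "nat \<Rightarrow> complex mat \<Rightarrow> complex mat \<Rightarrow> complex mat" where
  "completed_compression n E X = E * X * E + (1\<^sub>m n - E)"

lemma completed_compression_reduces:
  assumes E: "projection_mat n E" and X: "hermitian_mat n X"
  defines "Z \<equiv> completed_compression n E X"
  shows "hermitian_mat n Z" "Z * E = E * Z" "E * Z * E = E * X * E"
    "Z * (1\<^sub>m n - E) = 1\<^sub>m n - E"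
proof -
  define F where "F = 1\<^sub>m n - E"
  note hE = projection_matD(1)[OF E] and FF = projection_complement[OF E, folded F_def]
  note EE = projection_matD(2,3)[OF E]
  note dE = hermitian_matD[OF hE] and dF = hermitian_matD[OF FF(1)] and dX = hermitian_matD[OF X]
  have Z: "Z = E * X * E + F" by (simp add: Z_def completed_compression_def F_def)
  have hEX: "hermitian_mat n (E * X * E)" using hermitian_congruence[OF X dE(1)] dE by simp
  show "hermitian_mat n Z" unfolding Z by (intro hermitian_arith hEX FF(1))
  have ZE: "Z * E = E * X * E" "E * Z = E * X * E" "Z * F = F"
    unfolding Z using dE dF dX EE FF by (simp_all add: mat_ring)
  then show "Z * E = E * Z" "Z * (1\<^sub>m n - E) = 1\<^sub>m n - E" by (simp_all add: F_def)
  show "E * Z * E = E * X * E"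
    unfolding ZE(2) using dE dX EE by (simp add: mat_mult_assoc)
qed

lemma completed_compression_pd:
  assumes E: "projection_mat n E" and X: "pd_mat n X"
  shows "pd_mat n (completed_compression n E X)"
proof -
  define F where "F = 1\<^sub>m n - E"
  note hE = projection_matD(1)[OF E] and FF = projection_complement[OF E, folded F_def]
  note hX = psd_imp_hermitian[OF pd_imp_psd[OF X]]
  note dE = hermitian_matD[OF hE] and dF = hermitian_matD[OF FF(1)] and dX = hermitian_matD[OF hX]
  have "0 < qform (completed_compression n E X) v" if v: "v \<in> carrier_vec n" "v \<noteq> 0\<^sub>v n" for v
  proof -
    have c: "E *\<^sub>v v \<in> carrier_vec n" "F *\<^sub>v v \<in> carrier_vec n"
      by (rule mult_mat_vec_carrier[of _ n n]; use dE dF v in auto)+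
    have cc: "E * X * E \<in> carrier_mat n n" using dE dX by (auto intro!: carrier_matI)
    have "qform (E * X * E) v = qform X (E *\<^sub>v v)"
      using qform_congruence[OF dE(1) dX(1) v(1)] dE by simp
    moreover have "qform F v = Re ((F *\<^sub>v v) \<bullet>c (F *\<^sub>v v))"
      using qform_congruence[OF dF(1) one_carrier_mat v(1)] dF FF(4) c by (simp add: qform_one)
    ultimately have q: "qform (completed_compression n E X) v
        = qform X (E *\<^sub>v v) + Re ((F *\<^sub>v v) \<bullet>c (F *\<^sub>v v))"
      unfolding completed_compression_def F_def[symmetric] by (simp add: qform_arith(1)[OF cc dF(1) v(1)])
    have "v = E *\<^sub>v v + F *\<^sub>v v"
      using FF(5) v(1) by (simp flip: add_mult_distrib_mat_vec[OF dE(1) dF(1) v(1)])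
    then have "E *\<^sub>v v \<noteq> 0\<^sub>v n \<or> F *\<^sub>v v \<noteq> 0\<^sub>v n" using v(2) by auto
    then show ?thesis
    proof
      assume "E *\<^sub>v v \<noteq> 0\<^sub>v n"
      then have "0 < qform X (E *\<^sub>v v)" using X c by (simp add: pd_mat_iff)
      then show ?thesis unfolding q using Re_cscalar_prod_ge_0 by (rule add_pos_nonneg)
    next
      assume "F *\<^sub>v v \<noteq> 0\<^sub>v n"
      then have "0 < Re ((F *\<^sub>v v) \<bullet>c (F *\<^sub>v v))"
        using Re_cscalar_prod_eq_0[OF c(2)] Re_cscalar_prod_ge_0[of "F *\<^sub>v v"] by force
      moreover have "0 \<le> qform X (E *\<^sub>v v)" using pd_imp_psd[OF X] c by (simp add: psd_mat_iff)
      ultimately show ?thesis unfolding q by (rule add_nonneg_pos[rotated])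
    qed
  qed
  then show ?thesis
    using completed_compression_reduces(1)[OF E hX] by (simp add: pd_mat_iff)
qed

lemma operator_monotone_powr:
  assumes "0 < s" "s \<le> 1"
  shows "operator_monotone (\<lambda>x. x powr s)"
  using loewner_heinz assms unfolding operator_monotone_def mat_powr_def by blast

text \<open>The power acts on the two blocks separately. The complementary blocks agree, and on the range of \<open>E\<close>
this is the compression inequality for the operator monotone function \<open>x\<^sup>r\<close>.\<close>

lemma completed_compression_powr:
  assumes E: "projection_mat n E" and X: "psd_mat n X" and r: "0 < r" "r < 1"
  shows "loewner_ge n (mat_powr (completed_compression n E X) r)
    (completed_compression n E (mat_powr X r))"
proof -
  define F where "F = 1\<^sub>m n - E"
  note hE = projection_matD(1)[OF E] and FF = projection_complement[OF E, folded F_def]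
  note hX = psd_imp_hermitian[OF X]
  define Z where "Z = completed_compression n E X"
  note Z = completed_compression_reduces[OF E hX, folded Z_def F_def]
  note red = fun_calc_reducing_projection[OF E Z(1,2), of "\<lambda>x. x powr r", folded mat_powr_def]
  note dE = hermitian_matD[OF hE] and dF = hermitian_matD[OF FF(1)]
  note dZ = dim_fun_calc[OF Z(1), of "\<lambda>x. x powr r", folded mat_powr_def]
  have "mat_powr Z r * F = F * mat_powr (1\<^sub>m n) r"
    unfolding mat_powr_def
    by (rule fun_calc_intertwine[OF Z(1) hermitian_one dF(1)]) (use Z(4) dF in simp)
  also have "\<dots> = F"
    using dF fun_calc_one_mat[of "\<lambda>x. x powr r" n] by (simp add: mat_powr_def)
  finally have ZF: "mat_powr Z r * F = F" .
  have "mat_powr Z r = mat_powr Z r * (E + F)" unfolding FF(5) using dZ by simp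
  also have "\<dots> = mat_powr Z r * E + F" using dZ dE dF ZF by (simp add: mat_ring)
  also have "mat_powr Z r * E = mat_powr (E * X * E) r"
    using red(2) dE dZ projection_matD(2)[OF E] unfolding Z(3) red(1) by (simp add: mat_mult_assoc)
  also have "mat_powr (E * X * E) r = E * mat_powr (E * X * E) r * E"
  proof -
    have "E * mat_powr Z r * E = E * (E * mat_powr Z r * E) * E"
      using dE dZ projection_matD(2,3)[OF E] by (simp add: mat_mult_assoc)
    then show ?thesis using red(2) unfolding Z(3) by simp
  qed
  finally have Zr: "mat_powr Z r = E * mat_powr (E * X * E) r * E + F" .
  have "continuous_on {0..} (\<lambda>x::real. x powr r)"
    using r by (intro continuous_on_powr') (auto intro!: continuous_intros)
  from operator_monotone_compression[OF operator_monotone_powr this E X] r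
  have "loewner_ge n (E * mat_powr (E * X * E) r * E) (E * mat_powr X r * E)"
    by (simp add: mat_powr_def)
  from loewner_add[OF this loewner_refl[OF FF(1)]] show ?thesis
    unfolding Z_def[symmetric] Zr by (simp add: completed_compression_def F_def)
qed

context mean_function
begin

text \<open>This is the factored form with \<open>S = E\<close>. Completing the compression does not change the result because
it is cut down by \<open>E\<close> again.\<close>

lemma op_mean_pd_projection:
  assumes A: "pd_mat n A" and E: "projection_mat n E"
  shows "op_mean_pd f A E
    = E * fun_calc quotient (completed_compression n E (mat_powr A (-1))) * E"
proof -
  note hE = projection_matD(1)[OF E]
  note dE = hermitian_matD[OF hE]
  note hX = psd_imp_hermitian[OF pd_imp_psd[OF mat_powr_pd[OF A, of "-1"]]]
  note Z = completed_compression_reduces[OF E hX]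
  note dZ = dim_fun_calc[OF Z(1)]
  have "op_mean_pd f A E = E * fun_calc quotient (E * mat_powr A (-1) * E) * E"
    using op_mean_pd_factored[OF A dE(1)] unfolding dE(2) projection_matD(2)[OF E] .
  also have "fun_calc quotient (E * mat_powr A (-1) * E)
      = E * fun_calc quotient (completed_compression n E (mat_powr A (-1))) * E"
    using fun_calc_reducing_projection(2)[OF E Z(1,2), of quotient] unfolding Z(3) by simp
  finally show ?thesis
    using dE dZ projection_matD(2,3)[OF E] by (simp add: mat_mult_assoc)
qed

text \<open>Let \<open>g(x) = f(x) / x\<close> and let \<open>Z\<close> and \<open>Z\<^sub>r\<close> be the completed compressions of \<open>A\<^sup>-\<^sup>1\<close> and \<open>A\<^sup>-\<^sup>r\<close>. Then
\<open>Z\<^sub>r \<le> Z\<^sup>r\<close>, hence \<open>g(Z\<^sub>r) \<ge> g(Z\<^sup>r)\<close>, and \<open>g(Z\<^sup>r) \<ge> g(Z)\<^sup>r\<close> holds by the hypothesis on \<open>f\<close>, which passes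
to \<open>g\<close> on division by \<open>x\<^sup>r\<close>. Compressing by \<open>E\<close>, which commutes with \<open>g(Z)\<close>, gives the claim.\<close>

lemma op_mean_pd_projection_powr:
  assumes A: "pd_mat n A" and E: "projection_mat n E" and r: "0 < r" "r < 1"
    and fr: "\<And>x. 0 < x \<Longrightarrow> f x powr r \<le> f (x powr r)"
  shows "loewner_ge n (op_mean_pd f (mat_powr A r) E) (mat_powr (op_mean_pd f A E) r)"
proof -
  note hE = projection_matD(1)[OF E]
  note dE = hermitian_matD[OF hE]
  note hA = psd_imp_hermitian[OF pd_imp_psd[OF A]]
  define X where "X = mat_powr A (-1)"
  have X: "pd_mat n X" unfolding X_def by (rule mat_powr_pd[OF A])
  have Xr: "mat_powr (mat_powr A r) (-1) = mat_powr X r"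
    unfolding X_def by (simp add: mat_powr_powr[OF hA])
  define Z where "Z = completed_compression n E X"
  have Z: "pd_mat n Z" unfolding Z_def by (rule completed_compression_pd[OF E X])
  note hZ = psd_imp_hermitian[OF pd_imp_psd[OF Z]]
  note red = completed_compression_reduces[OF E psd_imp_hermitian[OF pd_imp_psd[OF X]], folded Z_def]
  have "loewner_ge n (mat_powr Z r) (completed_compression n E (mat_powr X r))"
    unfolding Z_def by (rule completed_compression_powr[OF E pd_imp_psd[OF X] r])
  then have "loewner_ge n (fun_calc quotient (completed_compression n E (mat_powr X r)))
      (fun_calc quotient (mat_powr Z r))"
    by (rule operator_monotone_quotient_antimono[OF mono cont f0
          completed_compression_pd[OF E mat_powr_pd[OF X]]])
  moreover have "loewner_ge n (fun_calc quotient (mat_powr Z r)) (fun_calc (\<lambda>x. quotient x powr r) Z)"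
    unfolding mat_powr_def fun_calc_comp[OF hZ]
  proof (rule fun_calc_mono_fun_pd[OF Z])
    fix x :: real assume "0 < x"
    then show "quotient x powr r \<le> quotient (x powr r)"
      using fr[of x] nonneg[of x] by (simp add: powr_divide divide_right_mono)
  qed
  ultimately have "loewner_ge n (fun_calc quotient (completed_compression n E (mat_powr X r)))
      (fun_calc (\<lambda>x. quotient x powr r) Z)"
    by (rule loewner_trans)
  from loewner_congruence[OF this dE(1)]
  have "loewner_ge n (op_mean_pd f (mat_powr A r) E) (E * fun_calc (\<lambda>x. quotient x powr r) Z * E)"
    unfolding op_mean_pd_projection[OF mat_powr_pd[OF A] E] Xr dE(2) .
  also have "E * fun_calc (\<lambda>x. quotient x powr r) Z * E = mat_powr (op_mean_pd f A E) r"
  proof -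
    have "fun_calc quotient Z * E = E * fun_calc quotient Z"
      by (rule fun_calc_reducing_projection(1)[OF E red(1,2), symmetric])
    from fun_calc_reducing_projection(2)[OF E fun_calc_hermitian[OF hZ] this, of "\<lambda>x. x powr r"]
    show ?thesis
      unfolding op_mean_pd_projection[OF A E] X_def[symmetric] Z_def[symmetric]
      unfolding mat_powr_def by (simp add: fun_calc_comp[OF hZ])
  qed
  finally show ?thesis .
qed

end

lemma powr_superadditive:
  fixes a b t :: real
  assumes "0 \<le> a" "0 \<le> b" "1 \<le> t"
  shows "a powr t + b powr t \<le> (a + b) powr t"
proof -
  have split: "x powr t = x * x powr (t - 1)" if "0 \<le> x" for x :: real
    using powr_add[of x 1 "t - 1"] that by simp
  have "a * a powr (t - 1) + b * b powr (t - 1) \<le> a * (a + b) powr (t - 1) + b * (a + b) powr (t - 1)"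
    using assms by (intro add_mono mult_left_mono powr_mono2) auto
  then show ?thesis
    using assms by (simp add: split distrib_right)
qed

theorem theorem3p3:
  fixes f :: "real \<Rightarrow> real" and A E :: "complex mat" and n :: nat and p q :: real
  assumes "\<forall>x\<ge>0. f x \<ge> 0"
    and "continuous_on {0..} f"
    and "operator_monotone f"
    and "f 1 = 1"
    and "f 0 = 0"
    and "\<forall>x>0. \<forall>r. 0 < r \<and> r < 1 \<longrightarrow> f (x powr r) \<ge> f x powr r"
    and "psd_mat n A"
    and "projection_mat n E"
    and "1 \<le> p" and "p < q"
  shows "loewner_ge n (mat_powr (op_mean f (mat_powr A p) E) (1 / p))
                      (mat_powr (op_mean f (mat_powr A q) E) (1 / q))"
proof -
  interpret mean_function f
    using assms(1-3,5) by unfold_locales auto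
  note A = assms(7) and E = assms(8)
  define r where "r = p / q"
  have r: "0 < r" "r < 1" "q * r = p" "r * (1 / p) = 1 / q" and pq: "0 < p" "0 < q"
    using assms(9,10) by (auto simp: r_def)
  have fr: "f x powr r \<le> f (x powr r)" if "0 < x" for x
    using assms(6) r that by blast
  note hA = psd_imp_hermitian[OF A]
  have pow: "psd_mat n (mat_powr A s)" for s by (rule mat_powr_psd[OF A])
  have pE: "psd_mat n E"
    using psd_gram[OF hermitian_matD(1)[OF projection_matD(1)[OF E]]]
    unfolding hermitian_matD(2)[OF projection_matD(1)[OF E]] projection_matD(2)[OF E] .
  \<comment> \<open>the first conjunct is the claim raised to the power p; taking p-th roots is monotone because \<open>p \<ge> 1\<close>\<close>
  have key: "loewner_ge n (op_mean f (mat_powr A p) E) (mat_powr (op_mean f (mat_powr A q) E) r) \<and>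
    psd_mat n (op_mean f (mat_powr A p) E) \<and> psd_mat n (op_mean f (mat_powr A q) E)"
  proof (cases "pd_mat n A")
    case True
    then have pd: "pd_mat n (mat_powr A s)" for s by (rule mat_powr_pd)
    have om: "op_mean f (mat_powr A s) E = op_mean_pd f (mat_powr A s) E" for s
      using pd hermitian_matD(3)[OF psd_imp_hermitian[OF pow]] by (simp add: op_mean_def)
    show ?thesis
      using op_mean_pd_projection_powr[OF pd[of q] E r(1,2) fr] op_mean_pd_psd[OF pd pE]
      by (simp add: om mat_powr_powr[OF hA] r(3))
  next
    case False
    have sing: "\<not> pd_mat n (mat_powr A s)" if "0 < s" for s
    proof
      assume "pd_mat n (mat_powr A s)"
      then have "pd_mat n (mat_powr (mat_powr A s) (1 / s))" by (rule mat_powr_pd)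
      then show False using that False by (simp add: mat_powr_powr[OF hA] mat_powr_1[OF A])
    qed
    let ?Mq = "op_mean f (mat_powr A q) E"
    have Mq: "psd_mat n ?Mq" by (rule op_mean_singular_psd[OF pow pE sing[OF pq(2)]])
    have "loewner_ge n (op_mean f (mat_powr A p) E) (mat_powr ?Mq r)"
    proof (rule op_mean_singular_greatest[OF pow pE sing[OF pq(1)] psd_imp_hermitian[OF mat_powr_psd[OF Mq]]])
      fix \<epsilon> :: real assume \<epsilon>: "0 < \<epsilon>"
      define B where "B = mat_powr A p + complex_of_real \<epsilon> \<cdot>\<^sub>m 1\<^sub>m n"
      have B: "pd_mat n B" unfolding B_def by (rule pd_shift[OF pow \<epsilon>])
      \<comment> \<open>A' is chosen so that its r-th power is the regularization B of \<open>A\<^sup>p\<close>; as \<open>1 / r \<ge> 1\<close>, it still dominates a regularization of \<open>A\<^sup>q\<close>.\<close>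
      define A' where "A' = mat_powr B (1 / r)"
      have A': "pd_mat n A'" unfolding A'_def by (rule mat_powr_pd[OF B])
      have B_eq: "mat_powr A' r = B"
        using r(1) unfolding A'_def
        by (simp add: mat_powr_powr[OF psd_imp_hermitian[OF pd_imp_psd[OF B]]] mat_powr_1[OF pd_imp_psd[OF B]])
      have "A' = fun_calc (\<lambda>x. (x powr p + \<epsilon>) powr (1 / r)) A"
        unfolding A'_def B_def fun_calc_shift[OF psd_imp_hermitian[OF pow]]
        by (simp add: mat_powr_def fun_calc_comp[OF hA])
      moreover have "mat_powr A q + complex_of_real (\<epsilon> powr (1 / r)) \<cdot>\<^sub>m 1\<^sub>m n
          = fun_calc (\<lambda>x. x powr q + \<epsilon> powr (1 / r)) A"
        unfolding fun_calc_shift[OF psd_imp_hermitian[OF pow]]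
        by (simp add: mat_powr_def fun_calc_comp[OF hA])
      moreover have "loewner_ge n (fun_calc (\<lambda>x. (x powr p + \<epsilon>) powr (1 / r)) A)
          (fun_calc (\<lambda>x. x powr q + \<epsilon> powr (1 / r)) A)"
      proof (rule fun_calc_mono_fun_psd[OF A])
        fix x :: real assume "0 \<le> x"
        have "p * (1 / r) = q" using pq by (simp add: r_def)
        then have "(x powr p) powr (1 / r) = x powr q" by (simp only: powr_powr)
        then show "x powr q + \<epsilon> powr (1 / r) \<le> (x powr p + \<epsilon>) powr (1 / r)"
          using powr_superadditive[of "x powr p" \<epsilon> "1 / r"] \<epsilon> r by simp
      qed
      ultimately have "loewner_ge n A' (mat_powr A q + complex_of_real (\<epsilon> powr (1 / r)) \<cdot>\<^sub>m 1\<^sub>m n)"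
        by simp
      then have "loewner_ge n (op_mean_pd f A' E) ?Mq"
        by (rule op_mean_singular_le[OF pow pE sing[OF pq(2)], rotated]) (use \<epsilon> in simp)
      then have "loewner_ge n (mat_powr (op_mean_pd f A' E) r) (mat_powr ?Mq r)"
        using r by (intro loewner_heinz op_mean_pd_psd[OF A' pE] Mq) auto
      moreover have "loewner_ge n (op_mean_pd f B E) (mat_powr (op_mean_pd f A' E) r)"
        using op_mean_pd_projection_powr[OF A' E r(1,2) fr] unfolding B_eq .
      ultimately show "loewner_ge n (op_mean_pd f (mat_powr A p + complex_of_real \<epsilon> \<cdot>\<^sub>m 1\<^sub>m n) E) (mat_powr ?Mq r)"
        unfolding B_def[symmetric] using loewner_trans by blast
    qed
    then show ?thesis
      using Mq op_mean_singular_psd[OF pow pE sing[OF pq(1)]] by blast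
  qed
  have "loewner_ge n (mat_powr (op_mean f (mat_powr A p) E) (1 / p))
      (mat_powr (mat_powr (op_mean f (mat_powr A q) E) r) (1 / p))"
    using key assms(9) by (intro loewner_heinz mat_powr_psd) auto
  moreover have "hermitian_mat n (op_mean f (mat_powr A q) E)"
    using key psd_imp_hermitian by blast
  ultimately show ?thesis by (simp only: mat_powr_powr r(4))
qed

end
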